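(* Let $G$ be a graph and $\theta$ a real number with $\mathrm{mult}(\theta,G)\ge2$, and let $H_1,\dots,H_q$ be the $\theta$-critical components of $G\setminus A_\theta(G)$. For distinct vertices $u,v$, $\mathrm{mult}(\theta,S_\theta(G)\setminus\{u,v\})=\mathrm{mult}(\theta,S_\theta(G))-1$ if and only if either (a) one of $u,v$ lies in $N_\theta(G)$ and the other in $B_\theta(G)$, or (b) $u,v\in V(H_{i_0})$ for some $i_0$ and $\mathrm{mult}(\theta,H_{i_0}\setminus\{u,v\})=0$.
   Context: All graphs are finite and simple. For a graph $G$ on $n$ vertices, let $p(G,r)$ be the number of $r$-matchings of $G$ ($p(G,0)=1$); the matching polynomial is $\mu(G,x)=\sum_{r=0}^{\lfloor n/2\rfloor}(-1)^r p(G,r)x^{n-2r}$. For real $\theta$, $\mathrm{mult}(\theta,G)$ is the multiplicity of $\theta$ as a root of $\mu(G,x)$ (it is $0$ if $\theta$ is not a root). $G\setminus X$ denotes deletion of the vertex set $X$; $G\setminus u=G\setminus\{u\}$. A vertex $u$ is $\theta$-essential, $\theta$-neutral, or $\theta$-positive in $G$ according as $\mathrm{mult}(\theta,G\setminus u)$ equals $\mathrm{mult}(\theta,G)-1$, $\mathrm{mult}(\theta,G)$, or $\mathrm{mult}(\theta,G)+1$. A vertex is $\theta$-special if it is not $\theta$-essential but is adjacent to a $\theta$-essential vertex. $B_\theta(G)$, $A_\theta(G)$, $N_\theta(G)$ are the sets of $\theta$-essential, $\theta$-special, $\theta$-neutral vertices. A connected graph is $\theta$-critical if all its vertices are $\theta$-essential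 in it. $S_\theta(G)$ is the graph on $V(G)$ whose edges are the edges of $G$ together with all pairs $\{w,z\}$, $z\neq w$, with $w\in A_\theta(G)$. *)

theory Defs
  imports "HOL-Computational_Algebra.Polynomial"
begin

type_synonym 'a graph = "'a set \<times> 'a set set"

definition verts :: "'a graph \<Rightarrow> 'a set" where "verts G = fst G"
definition edges :: "'a graph \<Rightarrow> 'a set set" where "edges G = snd G"

definition simple_graph :: "'a graph \<Rightarrow> bool" where
  "simple_graph G \<longleftrightarrow> finite (verts G) \<and>
     (\<forall>e\<in>edges G. \<exists>u v. u \<noteq> v \<and> u \<in> verts G \<and> v \<in> verts G \<and> e = {u, v})"

definition del_verts :: "'a graph \<Rightarrow> 'a set \<Rightarrow> 'a graph" where
  "del_verts G X = (verts G - X, {e \<in> edges G. e \<inter> X = {}})"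

definition matchings :: "'a graph \<Rightarrow> nat \<Rightarrow> 'a set set set" where
  "matchings G r = {M. M \<subseteq> edges G \<and> card M = r \<and>
      (\<forall>e\<in>M. \<forall>f\<in>M. e \<noteq> f \<longrightarrow> e \<inter> f = {})}"

definition num_matchings :: "'a graph \<Rightarrow> nat \<Rightarrow> nat" where
  "num_matchings G r = card (matchings G r)"

definition matching_poly :: "'a graph \<Rightarrow> real poly" where
  "matching_poly G = (\<Sum>r\<le>card (verts G) div 2.
      monom ((-1) ^ r * real (num_matchings G r)) (card (verts G) - 2 * r))"

definition mult :: "real \<Rightarrow> 'a graph \<Rightarrow> nat" where
  "mult \<theta> G = order \<theta> (matching_poly G)"

definition essential :: "real \<Rightarrow> 'a graph \<Rightarrow> 'a \<Rightarrow> bool" where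
  "essential \<theta> G u \<longleftrightarrow> int (mult \<theta> (del_verts G {u})) = int (mult \<theta> G) - 1"

definition neutral :: "real \<Rightarrow> 'a graph \<Rightarrow> 'a \<Rightarrow> bool" where
  "neutral \<theta> G u \<longleftrightarrow> mult \<theta> (del_verts G {u}) = mult \<theta> G"

definition B_set :: "real \<Rightarrow> 'a graph \<Rightarrow> 'a set" where
  "B_set \<theta> G = {u \<in> verts G. essential \<theta> G u}"

definition A_set :: "real \<Rightarrow> 'a graph \<Rightarrow> 'a set" where
  "A_set \<theta> G = {u \<in> verts G. \<not> essential \<theta> G u \<and>
      (\<exists>w \<in> B_set \<theta> G. {u, w} \<in> edges G)}"

definition N_set :: "real \<Rightarrow> 'a graph \<Rightarrow> 'a set" where
  "N_set \<theta> G = {u \<in> verts G. neutral \<theta> G u}"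

definition adj :: "'a graph \<Rightarrow> 'a \<Rightarrow> 'a \<Rightarrow> bool" where
  "adj G u v \<longleftrightarrow> {u, v} \<in> edges G"

definition connected :: "'a graph \<Rightarrow> bool" where
  "connected G \<longleftrightarrow> verts G \<noteq> {} \<and> (\<forall>u\<in>verts G. \<forall>v\<in>verts G. (adj G)\<^sup>*\<^sup>* u v)"

definition induced :: "'a graph \<Rightarrow> 'a set \<Rightarrow> 'a graph" where
  "induced G C = (C, {e \<in> edges G. e \<subseteq> C})"

definition component_of :: "'a graph \<Rightarrow> 'a graph \<Rightarrow> bool" where
  "component_of H G \<longleftrightarrow> (\<exists>C. C \<subseteq> verts G \<and> H = induced G C \<and> connected H \<and>
      (\<forall>D. C \<subset> D \<and> D \<subseteq> verts G \<longrightarrow> \<not> connected (induced G D)))"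

definition critical :: "real \<Rightarrow> 'a graph \<Rightarrow> bool" where
  "critical \<theta> H \<longleftrightarrow> connected H \<and> (\<forall>u\<in>verts H. essential \<theta> H u)"

definition S_graph :: "real \<Rightarrow> 'a graph \<Rightarrow> 'a graph" where
  "S_graph \<theta> G = (verts G, edges G \<union>
      {{w, z} | w z. w \<in> A_set \<theta> G \<and> z \<in> verts G \<and> z \<noteq> w})"

end

(*
  Write mu(U) for the matching polynomial of the subgraph induced on U.  The difference
  mu(V-u) mu(V-v) - mu(V) mu(V-uv) is nonnegative on the real line (Heilmann-Lieb), so its order
  at theta is even and at most the order of every nonnegative function that it dominates.  Comparing
  orders yields interlacing and shows that special vertices are positive.  Nonnegativity persists
  when one vertex weight is perturbed by z; the resulting discriminant condition in z gives the
  stability lemma: deleting a special vertex raises mult(theta, G-v) by one for every other v.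
  Hence mult(theta, G-A) = mult(theta, G) + |A|, vertices outside A keep their type, and
  Gallai's lemma follows.  Conversely, a vertex joined to everything lowers a positive multiplicity
  by exactly one, so mult(theta, S-X) is obtained from mult(theta, G-A-X) by subtracting |A-X|;
  the hypothesis mult(theta, G) >= 2 keeps all multiplicities positive while A is added back.
  The theorem then becomes a statement about G-A, whose essential vertices fill whole components.
*)
theory Submission
  imports Defs
begin

subsection \<open>Nonnegative real polynomials\<close>

text \<open>A nonnegative function vanishes at \<open>\<theta>\<close> at least to the order of any
  upper bound. In the induction step \<open>(x - \<theta>) ^ n\<close> is already divided out of
  \<open>p\<close>; away from \<open>\<theta>\<close> the cofactor is bounded by
  \<open>|x - \<theta>| * |r' x|\<close>, so by continuity it vanishes at
  \<open>\<theta>\<close>.\<close>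

lemma power_dvd_nonneg_le:
  fixes p r :: "real poly"
  assumes "\<And>x. 0 \<le> poly p x" and "\<And>x. poly p x \<le> poly r x" and "[:-\<theta>, 1:] ^ n dvd r"
  shows "[:-\<theta>, 1:] ^ n dvd p"
  using assms(3)
proof (induction n)
  case (Suc n)
  obtain r' where r': "r = [:-\<theta>, 1:] ^ Suc n * r'" using Suc.prems by blast
  have "[:-\<theta>, 1:] ^ n dvd p"
    using Suc by (meson dvd_trans le_imp_power_dvd lessI less_imp_le)
  then obtain p' where p': "p = [:-\<theta>, 1:] ^ n * p'" by blast
  have le: "\<bar>poly p' x\<bar> \<le> \<bar>x - \<theta>\<bar> * \<bar>poly r' x\<bar>" if "x \<noteq> \<theta>" for x
  proof -
    have "\<bar>poly p x\<bar> \<le> \<bar>poly r x\<bar>"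
      using assms(1,2)[of x] by linarith
    moreover have "poly p x = (x - \<theta>) ^ n * poly p' x" "poly r x = (x - \<theta>) ^ n * ((x - \<theta>) * poly r' x)"
      by (simp_all add: r' p' algebra_simps)
    ultimately have "\<bar>x - \<theta>\<bar> ^ n * \<bar>poly p' x\<bar> \<le> \<bar>x - \<theta>\<bar> ^ n * (\<bar>x - \<theta>\<bar> * \<bar>poly r' x\<bar>)"
      by (simp only: abs_mult power_abs)
    then show ?thesis using that by simp
  qed
  have "((\<lambda>x. \<bar>poly p' x\<bar>) \<longlongrightarrow> \<bar>poly p' \<theta>\<bar>) (at \<theta>)"
    by (intro tendsto_intros)
  moreover have "((\<lambda>x. \<bar>x - \<theta>\<bar> * \<bar>poly r' x\<bar>) \<longlongrightarrow> \<bar>\<theta> - \<theta>\<bar> * \<bar>poly r' \<theta>\<bar>) (at \<theta>)"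
    by (intro tendsto_intros)
  moreover have "\<forall>\<^sub>F x in at \<theta>. \<bar>poly p' x\<bar> \<le> \<bar>x - \<theta>\<bar> * \<bar>poly r' x\<bar>"
    using le by (simp add: eventually_at_filter)
  ultimately have "\<bar>poly p' \<theta>\<bar> \<le> \<bar>\<theta> - \<theta>\<bar> * \<bar>poly r' \<theta>\<bar>"
    using tendsto_le[OF at_neq_bot] by blast
  then have "[:-\<theta>, 1:] dvd p'" by (simp add: poly_eq_0_iff_dvd[symmetric])
  then show ?case unfolding p' power_Suc2 by (rule mult_dvd_mono[OF dvd_refl])
qed simp

text \<open>An odd power of \<open>x - \<theta>\<close> changes sign at \<open>\<theta>\<close>, so
  the cofactor is nonnegative on the right and nonpositive on the left, hence zero at
  \<open>\<theta>\<close>.\<close>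

lemma power_dvd_nonneg_even:
  fixes p :: "real poly"
  assumes nn: "\<And>x. 0 \<le> poly p x" and "[:-\<theta>, 1:] ^ n dvd p" and "odd n"
  shows "[:-\<theta>, 1:] ^ Suc n dvd p"
proof -
  obtain q where q: "p = [:-\<theta>, 1:] ^ n * q" using assms by blast
  have pos: "0 \<le> poly q x" if "x > \<theta>" for x
  proof -
    have "(x - \<theta>) ^ n > 0" using that by simp
    then show ?thesis using nn[of x] by (simp add: q zero_le_mult_iff)
  qed
  have neg: "poly q x \<le> 0" if "x < \<theta>" for x
  proof -
    have "(x - \<theta>) ^ n < 0" using that \<open>odd n\<close> by simp
    moreover have "0 \<le> (x - \<theta>) ^ n * poly q x" using nn[of x] by (simp add: q)
    ultimately show ?thesis by (meson not_le mult_neg_pos)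
  qed
  have lim: "(poly q \<longlongrightarrow> poly q \<theta>) (at \<theta> within S)" for S
    by (intro tendsto_intros)
  have "\<forall>\<^sub>F x in at_right \<theta>. 0 \<le> poly q x"
    using pos by (simp add: eventually_at_filter)
  then have "0 \<le> poly q \<theta>"
    by (rule tendsto_lowerbound[OF lim]) simp
  moreover have "\<forall>\<^sub>F x in at_left \<theta>. poly q x \<le> 0"
    using neg by (simp add: eventually_at_filter)
  then have "poly q \<theta> \<le> 0"
    by (rule tendsto_upperbound[OF lim]) simp
  ultimately have "[:-\<theta>, 1:] dvd q" by (simp add: poly_eq_0_iff_dvd[symmetric])
  then show ?thesis unfolding q power_Suc2 by (rule mult_dvd_mono[OF dvd_refl])
qed

lemma discriminant_le:
  fixes a b c :: real
  assumes q: "\<And>z. 0 \<le> a + z * b + z\<^sup>2 * c" and "0 \<le> c"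
  shows "b\<^sup>2 \<le> 4 * a * c"
proof (cases "c = 0")
  case True
  \<comment> \<open>For nonzero \<open>b\<close> the chosen argument would give the affine function
    the value -1.\<close>
  have "b = 0"
    using q[of "- (a + 1) / b"] True by (cases "b = 0") auto
  then show ?thesis using True by simp
next
  case False
  then have "0 < c" using assms by simp
  \<comment> \<open>Evaluation at the vertex of the parabola.\<close>
  then show ?thesis using q[of "- b / (2 * c)"]
    by (simp add: field_simps power2_eq_square)
qed

subsection \<open>Matching polynomials of induced subgraphs\<close>

text \<open>The edge set is fixed and only the vertex set varies, so vertex deletion becomes set
  difference and \<open>mu\<close> a function of vertex sets.\<close>

locale edge_set =
  fixes E :: "'a set set"
  assumes edgeE: "e \<in> E \<Longrightarrow> \<exists>u v. u \<noteq> v \<and> e = {u, v}"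
begin

lemma edge_neq: "{u, v} \<in> E \<Longrightarrow> u \<noteq> v"
  using edgeE[of "{u, v}"] by (auto simp: doubleton_eq_iff)

definition nbrs :: "'a set \<Rightarrow> 'a \<Rightarrow> 'a set" where
  "nbrs V u = {v \<in> V. {u, v} \<in> E}"

lemma finite_nbrs [simp]: "finite V \<Longrightarrow> finite (nbrs V u)"
  by (simp add: nbrs_def)

definition match :: "'a set \<Rightarrow> 'a set set set" where
  "match V = {M. M \<subseteq> {e \<in> E. e \<subseteq> V} \<and> (\<forall>e\<in>M. \<forall>f\<in>M. e \<noteq> f \<longrightarrow> e \<inter> f = {})}"

definition mu :: "'a set \<Rightarrow> real poly" where
  "mu V = matching_poly (V, {e \<in> E. e \<subseteq> V})"

lemma finite_match: "finite V \<Longrightarrow> finite (match V)"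
  by (rule finite_subset[of _ "Pow (Pow V)"]) (auto simp: match_def)

lemma match_finite: "finite V \<Longrightarrow> M \<in> match V \<Longrightarrow> finite M"
  by (rule finite_subset[of _ "Pow V"]) (auto simp: match_def)

lemma match_card:
  assumes "finite V" "M \<in> match V"
  shows "2 * card M \<le> card V"
proof -
  have "card e = 2" if "e \<in> M" for e
  proof -
    have "e \<in> E" using assms that by (auto simp: match_def)
    then show ?thesis using edgeE[of e] by auto
  qed
  moreover have "card (\<Union>M) = sum card M"
    using assms by (intro card_Union_disjoint) 
      (auto simp: match_def pairwise_def disjnt_def dest: finite_subset)
  ultimately have "card (\<Union>M) = 2 * card M" by simp
  moreover have "card (\<Union>M) \<le> card V"
    using assms by (intro card_mono) (auto simp: match_def)
  ultimately show ?thesis by simp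
qed

text \<open>Matchings are grouped by size; \<open>match_card\<close> shows that no size exceeds the
  summation bound in \<open>matching_poly\<close>.\<close>

lemma mu_sum:
  assumes "finite V"
  shows "mu V = (\<Sum>M\<in>match V. monom ((-1) ^ card M) (card V - 2 * card M))"
proof -
  let ?h = "\<lambda>M :: 'a set set. monom ((-1::real) ^ card M) (card V - 2 * card M)"
  have "monom ((-1) ^ r * real (num_matchings (V, {e \<in> E. e \<subseteq> V}) r)) (card V - 2 * r)
      = sum ?h {M \<in> match V. card M = r}" for r
  proof -
    have "matchings (V, {e \<in> E. e \<subseteq> V}) r = {M \<in> match V. card M = r}"
      by (auto simp: matchings_def match_def edges_def)
    moreover have "sum ?h {M \<in> match V. card M = r}
        = (\<Sum>M\<in>{M \<in> match V. card M = r}. monom ((-1) ^ r) (card V - 2 * r))"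
      by (rule sum.cong) auto
    ultimately show ?thesis
      by (simp add: num_matchings_def of_nat_poly smult_monom mult.commute)
  qed
  then have "mu V = (\<Sum>r\<le>card V div 2. sum ?h {M \<in> match V. card M = r})"
    by (simp add: mu_def matching_poly_def verts_def)
  also have "\<dots> = sum ?h (match V)"
    using assms match_card[OF assms]
    by (intro sum.group) (force simp: finite_match)+
  finally show ?thesis .
qed

text \<open>A matching either avoids \<open>u\<close> or has exactly one edge \<open>{u, v}\<close>
  at \<open>u\<close>, and removing it leaves a matching that avoids both ends.\<close>

lemma match_split:
  assumes "u \<in> V"
  shows "match V = match (V - {u}) \<union> (\<Union>v\<in>nbrs V u. insert {u, v} ` match (V - {u, v}))"
    (is "_ = ?A \<union> ?B")
proof (intro equalityI subsetI)
  fix M assume M: "M \<in> match V"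
  show "M \<in> ?A \<union> ?B"
  proof (cases "u \<in> \<Union>M")
    case False
    then show ?thesis using M by (auto simp: match_def)
  next
    case True
    then obtain e where e: "e \<in> M" "u \<in> e" by auto
    then have eE: "e \<in> E" "e \<subseteq> V" using M by (auto simp: match_def)
    then obtain v where v: "e = {u, v}" "u \<noteq> v"
      using edgeE[of e] e by (metis doubleton_eq_iff insertE singletonD)
    then have v: "e = {u, v}" "u \<noteq> v" "v \<in> V" "{u, v} \<in> E" using eE by auto
    have "f \<inter> e = {}" if "f \<in> M - {e}" for f
      using M e that by (auto simp: match_def)
    then have "M - {e} \<in> match (V - {u, v})"
      using M v by (fastforce simp: match_def)
    moreover have "M = insert {u, v} (M - {e})" using e v by auto
    moreover have "v \<in> nbrs V u" using v by (simp add: nbrs_def)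
    ultimately show ?thesis by blast
  qed
next
  fix M assume "M \<in> ?A \<union> ?B"
  then show "M \<in> match V"
  proof
    assume "M \<in> ?B"
    then obtain v M' where v: "v \<in> V" "{u, v} \<in> E" "M = insert {u, v} M'" "M' \<in> match (V - {u, v})"
      by (auto simp: nbrs_def)
    then have *: "\<And>e. e \<in> M' \<Longrightarrow> e \<in> E \<and> e \<subseteq> V \<and> e \<inter> {u, v} = {}"
      and "\<And>e f. e \<in> M' \<Longrightarrow> f \<in> M' \<Longrightarrow> e \<noteq> f \<Longrightarrow> e \<inter> f = {}"
      by (auto simp: match_def)
    then show ?thesis using v assms unfolding match_def by blast
  qed (auto simp: match_def)
qed

text \<open>Apply \<open>match_split\<close>: a matching avoiding \<open>u\<close> gains one
  unmatched vertex, hence a factor x; adding the edge \<open>{u, v}\<close> flips the sign and keeps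
  the exponent.\<close>

lemma mu_rec:
  assumes V: "finite V" and u: "u \<in> V"
  shows "mu V = [:0, 1:] * mu (V - {u}) - (\<Sum>v\<in>nbrs V u. mu (V - {u, v}))"
proof -
  let ?h = "\<lambda>V. \<lambda>M :: 'a set set. monom ((-1::real) ^ card M) (card V - 2 * card M)"
  have notin: "{u, v} \<notin> M" if "M \<in> match (V - {u, w})" for M v w
    using that by (auto simp: match_def)
  have notin': "{u, v} \<notin> M" if "M \<in> match (V - {u})" for M v
    using that by (auto simp: match_def)
  have 1: "mu V = sum (?h V) (match (V - {u}))
      + sum (?h V) (\<Union>v\<in>nbrs V u. insert {u, v} ` match (V - {u, v}))"
    unfolding mu_sum[OF V] by (subst match_split[OF u], rule sum.union_disjoint)
      (use V notin' in \<open>auto simp: finite_match\<close>)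
  have 2: "sum (?h V) (match (V - {u})) = [:0, 1:] * mu (V - {u})"
    unfolding mu_sum[OF finite_Diff[OF V]] sum_distrib_left
  proof (rule sum.cong[OF refl])
    fix M assume "M \<in> match (V - {u})"
    then have "2 * card M \<le> card (V - {u})" using V by (intro match_card) auto
    moreover have "card V = Suc (card (V - {u}))" using card.remove[OF V u] .
    \<comment> \<open>The bound on \<open>card M\<close> keeps the truncated subtraction
      exact.\<close>
    ultimately have "card V - 2 * card M = Suc (card (V - {u}) - 2 * card M)" by simp
    then show "?h V M = [:0, 1:] * ?h (V - {u}) M" by (simp add: monom_Suc)
  qed
  have "sum (?h V) (\<Union>v\<in>nbrs V u. insert {u, v} ` match (V - {u, v}))
      = (\<Sum>v\<in>nbrs V u. sum (?h V) (insert {u, v} ` match (V - {u, v})))"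
  proof (rule sum.UNION_disjoint)
    show "\<forall>i\<in>nbrs V u. \<forall>j\<in>nbrs V u. i \<noteq> j \<longrightarrow>
        insert {u, i} ` match (V - {u, i}) \<inter> insert {u, j} ` match (V - {u, j}) = {}"
    proof (intro ballI impI, rule ccontr)
      fix i j assume ij: "i \<noteq> j" and
        "insert {u, i} ` match (V - {u, i}) \<inter> insert {u, j} ` match (V - {u, j}) \<noteq> {}"
      then obtain M M' where "insert {u, i} M = insert {u, j} M'" "M \<in> match (V - {u, i})"
        by auto
      then show False using ij notin[of M i j] by (metis doubleton_eq_iff insert_iff)
    qed
  qed (use V in \<open>auto simp: finite_match\<close>)
  also have "\<dots> = (\<Sum>v\<in>nbrs V u. - mu (V - {u, v}))"
  proof (rule sum.cong[OF refl])
    fix v assume v: "v \<in> nbrs V u"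
    then have "u \<noteq> v" "v \<in> V" using edge_neq by (auto simp: nbrs_def)
    then have c: "card V - 2 = card (V - {u, v})"
      using V u by (simp add: card_Diff_subset)
    have "inj_on (insert {u, v}) (match (V - {u, v}))"
      using notin by (meson inj_onI insert_ident)
    then have "sum (?h V) (insert {u, v} ` match (V - {u, v}))
        = (\<Sum>M\<in>match (V - {u, v}). ?h V (insert {u, v} M))"
      by (simp add: sum.reindex)
    also have "\<dots> = (\<Sum>M\<in>match (V - {u, v}). - ?h (V - {u, v}) M)"
    proof (rule sum.cong[OF refl])
      fix M assume M: "M \<in> match (V - {u, v})"
      then have "finite M" using V by (meson finite_Diff match_finite)
      then show "?h V (insert {u, v} M) = - ?h (V - {u, v}) M"
        using notin[OF M, of v] by (simp add: c[symmetric] minus_monom)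
    qed
    also have "\<dots> = - mu (V - {u, v})"
      using V by (simp add: mu_sum sum_negf)
    finally show "sum (?h V) (insert {u, v} ` match (V - {u, v})) = - mu (V - {u, v})" .
  qed
  finally show ?thesis unfolding 1 2 by (simp add: sum_negf)
qed

lemma mu_empty [simp]: "mu {} = 1"
proof -
  have "match {} = {{}}" using edgeE by (force simp: match_def)
  then show ?thesis by (simp add: mu_sum)
qed

text \<open>Only the empty matching contributes to the coefficient of degree \<open>card V\<close>,
  so the polynomial is monic.\<close>

lemma mu_nz [simp]: "finite V \<Longrightarrow> mu V \<noteq> 0"
proof -
  assume V: "finite V"
  have "{} \<in> match V" by (simp add: match_def)
  have "coeff (mu V) (card V) = (\<Sum>M\<in>match V. if M = {} then 1 else 0)"
    unfolding mu_sum[OF V] coeff_sum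
  proof (rule sum.cong[OF refl])
    fix M assume M: "M \<in> match V"
    have "finite M" using match_finite[OF V M] .
    then have "card V - 2 * card M = card V \<longleftrightarrow> M = {}"
      using match_card[OF V M] by (cases "card M") auto
    then show "coeff (monom ((-1) ^ card M) (card V - 2 * card M)) (card V) = (if M = {} then 1 else (0::real))"
      by auto
  qed
  also have "\<dots> = 1" using V \<open>{} \<in> match V\<close> by (simp add: finite_match)
  finally show ?thesis by auto
qed


subsection \<open>The Heilmann-Lieb inequality\<close>

text \<open>\<open>F\<close> is determined up to the constant \<open>F {}\<close>: it is the matching polynomial with weight
  \<open>y v\<close> on an unmatched vertex \<open>v\<close>. The value \<open>F {}\<close> is irrelevant below.\<close>

definition weighted :: "('a \<Rightarrow> real) \<Rightarrow> ('a set \<Rightarrow> real) \<Rightarrow> bool" where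
  "weighted y F \<longleftrightarrow> (\<forall>V u. finite V \<longrightarrow> u \<in> V \<longrightarrow>
      F V = y u * F (V - {u}) - (\<Sum>v\<in>nbrs V u. F (V - {u, v})))"

lemma weightedD:
  "weighted y F \<Longrightarrow> finite V \<Longrightarrow> u \<in> V \<Longrightarrow>
     F V = y u * F (V - {u}) - (\<Sum>v\<in>nbrs V u. F (V - {u, v}))"
  unfolding weighted_def by blast

text \<open>For matching polynomials this equals the sum over paths P from \<open>u\<close> to
  \<open>v\<close> of the squares of \<open>mu (V - P)\<close>. The ring is left general so that
  both polynomials and their values at a point are covered.\<close>

definition rayleigh :: "('a set \<Rightarrow> 'b::comm_ring_1) \<Rightarrow> 'a set \<Rightarrow> 'a \<Rightarrow> 'a \<Rightarrow> 'b" where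
  "rayleigh F V u v = F (V - {u}) * F (V - {v}) - F V * F (V - {u, v})"

text \<open>Expanding \<open>F V\<close> and \<open>F (V - {v})\<close> at \<open>u\<close> cancels
  the terms with \<open>y u\<close>. The neighbour \<open>v\<close> leaves a square, every other
  neighbour \<open>w\<close> the same expression one step further along a path to
  \<open>v\<close>.\<close>

lemma rayleigh_rec:
  assumes F: "weighted y F" and V: "finite V" "u \<in> V" "v \<in> V" "u \<noteq> v"
  shows "rayleigh F V u v = (if {u, v} \<in> E then (F (V - {u, v}))\<^sup>2 else 0)
      + (\<Sum>w\<in>nbrs (V - {v}) u. rayleigh F (V - {u}) w v)"
proof -
  let ?N = "nbrs (V - {v}) u"
  have fin: "finite ?N" using V by simp
  have N: "nbrs V u = (if {u, v} \<in> E then insert v ?N else ?N)" "v \<notin> ?N"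
    using V by (auto simp: nbrs_def)
  have s1: "V - {v} - {u} = V - {u, v}" by auto
  have 1: "F V = y u * F (V - {u}) - ((if {u, v} \<in> E then F (V - {u, v}) else 0) + (\<Sum>w\<in>?N. F (V - {u, w})))"
    using weightedD[OF F V(1,2)] fin N by simp
  have 2: "F (V - {v}) = y u * F (V - {u, v}) - (\<Sum>w\<in>?N. F (V - {v} - {u, w}))"
    using weightedD[OF F, of "V - {v}" u] V by (simp add: s1)
  have "rayleigh F (V - {u}) w v = F (V - {u, w}) * F (V - {u, v}) - F (V - {u}) * F (V - {v} - {u, w})" for w
  proof -
    have "V - {u} - {w} = V - {u, w}" "V - {u} - {v} = V - {u, v}" "V - {u} - {w, v} = V - {v} - {u, w}"
      by auto
    then show ?thesis by (simp add: rayleigh_def)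
  qed
  then have 3: "(\<Sum>w\<in>?N. rayleigh F (V - {u}) w v)
      = (\<Sum>w\<in>?N. F (V - {u, w})) * F (V - {u, v}) - F (V - {u}) * (\<Sum>w\<in>?N. F (V - {v} - {u, w}))"
    by (simp add: sum_subtractf sum_distrib_left sum_distrib_right)
  show ?thesis
    unfolding 3 unfolding rayleigh_def 1 2 by (simp add: algebra_simps power2_eq_square)
qed

lemma rayleigh_nonneg:
  assumes "weighted y F" "finite V" "u \<in> V" "v \<in> V" "u \<noteq> v"
  shows "0 \<le> rayleigh F V u v"
  using assms(2,1,3-)
proof (induction V arbitrary: u rule: finite_psubset_induct)
  case (psubset V)
  have "0 \<le> (\<Sum>w\<in>nbrs (V - {v}) u. rayleigh F (V - {u}) w v)"
  proof (rule sum_nonneg)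
    fix w assume "w \<in> nbrs (V - {v}) u"
    then show "0 \<le> rayleigh F (V - {u}) w v"
      using psubset.prems by (intro psubset.IH) (auto simp: nbrs_def dest: edge_neq)
  qed
  then show ?case by (simp add: rayleigh_rec[OF psubset.prems(1) psubset.hyps psubset.prems(2-)])
qed

lemma rayleigh_ge_edge:
  assumes "weighted y F" "finite V" "u \<in> V" "v \<in> V" "{u, v} \<in> E"
  shows "(F (V - {u, v}))\<^sup>2 \<le> rayleigh F V u v"
proof -
  have "u \<noteq> v" using assms edge_neq by blast
  moreover have "0 \<le> (\<Sum>w\<in>nbrs (V - {v}) u. rayleigh F (V - {u}) w v)"
    using assms \<open>u \<noteq> v\<close> by (intro sum_nonneg rayleigh_nonneg) (auto simp: nbrs_def dest: edge_neq)
  ultimately show ?thesis using assms by (simp add: rayleigh_rec)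
qed

text \<open>Every term of the recursion is nonnegative, so a single summand is a lower bound. This
  later passes divisibility from \<open>V\<close> to \<open>V - {u}\<close> along an edge.\<close>

lemma rayleigh_ge_step:
  assumes "weighted y F" "finite V" "u \<in> V" "v \<in> V" "u \<noteq> v"
    and w: "w \<in> V" "w \<noteq> v" "{u, w} \<in> E"
  shows "rayleigh F (V - {u}) w v \<le> rayleigh F V u v"
proof -
  have "rayleigh F (V - {u}) w v \<le> (\<Sum>w\<in>nbrs (V - {v}) u. rayleigh F (V - {u}) w v)"
    using assms by (intro member_le_sum rayleigh_nonneg) (auto simp: nbrs_def dest: edge_neq)
  then show ?thesis using assms(1-5) by (simp add: rayleigh_rec add_increasing)
qed

definition mu_at :: "real \<Rightarrow> 'a set \<Rightarrow> real" where "mu_at x V = poly (mu V) x"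

lemma weighted_mu_at: "weighted (\<lambda>_. x) (mu_at x)"
  unfolding weighted_def mu_at_def by (auto simp: mu_rec poly_sum)

lemma poly_rayleigh: "poly (rayleigh mu V u v) x = rayleigh (mu_at x) V u v"
  by (simp add: rayleigh_def mu_at_def)

text \<open>Raises the weight of the single vertex \<open>s\<close> from \<open>x\<close> to \<open>x + z\<close>.\<close>

definition mu_shift :: "real \<Rightarrow> 'a \<Rightarrow> real \<Rightarrow> 'a set \<Rightarrow> real" where
  "mu_shift x s z V = (if s \<in> V then mu_at x V + z * mu_at x (V - {s}) else mu_at x V)"

text \<open>The weighted polynomial is affine in the weight of \<open>s\<close>, with slope given by
  deleting \<open>s\<close>. At \<open>u = s\<close> the recurrence gains just that slope term;
  otherwise the recurrences for \<open>V\<close> and \<open>V - {s}\<close> are combined with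
  coefficients 1 and \<open>z\<close>.\<close>

lemma weighted_mu_shift: "weighted ((\<lambda>_. x)(s := x + z)) (mu_shift x s z)"
  unfolding weighted_def
proof (intro allI impI)
  fix V :: "'a set" and u assume V: "finite V" "u \<in> V"
  note rec = weightedD[OF weighted_mu_at, of _ _ x]
  show "mu_shift x s z V = ((\<lambda>_. x)(s := x + z)) u * mu_shift x s z (V - {u}) - (\<Sum>v\<in>nbrs V u. mu_shift x s z (V - {u, v}))"
  proof (cases "u = s")
    case True
    then have "mu_shift x s z V = mu_at x V + z * mu_at x (V - {s})" using V by (simp add: mu_shift_def)
    also have "mu_at x V = x * mu_at x (V - {s}) - (\<Sum>v\<in>nbrs V s. mu_at x (V - {s, v}))"
      using rec V True by blast
    finally show ?thesis using True by (simp add: mu_shift_def algebra_simps)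
  next
    case False
    show ?thesis
    proof (cases "s \<in> V")
      case True
      have sw: "V - {s} - {u} = V - {u} - {s}" by auto
      have 1: "mu_at x V = x * mu_at x (V - {u}) - (\<Sum>v\<in>nbrs V u. mu_at x (V - {u, v}))"
        using rec V by blast
      have 2: "mu_at x (V - {s}) = x * mu_at x (V - {u} - {s}) - (\<Sum>v\<in>nbrs (V - {s}) u. mu_at x (V - {s} - {u, v}))"
        using rec[of "V - {s}" u] V False by (simp add: sw)
      have N: "nbrs V u = (if {u, s} \<in> E then insert s (nbrs (V - {s}) u) else nbrs (V - {s}) u)"
        "s \<notin> nbrs (V - {s}) u"
        using True by (auto simp: nbrs_def)
      have "(\<Sum>v\<in>nbrs (V - {s}) u. mu_shift x s z (V - {u, v}))
          = (\<Sum>v\<in>nbrs (V - {s}) u. mu_at x (V - {u, v}) + z * mu_at x (V - {s} - {u, v}))"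
      proof (rule sum.cong[OF refl])
        fix v assume "v \<in> nbrs (V - {s}) u"
        moreover have "V - {s} - {u, v} = V - {u, v} - {s}" by auto
        ultimately show "mu_shift x s z (V - {u, v}) = mu_at x (V - {u, v}) + z * mu_at x (V - {s} - {u, v})"
          using False True by (auto simp: mu_shift_def nbrs_def)
      qed
      \<comment> \<open>A neighbour \<open>v = s\<close> contributes no multiple of
        \<open>z\<close>, since \<open>s\<close> is then already deleted.\<close>
      then have 3: "(\<Sum>v\<in>nbrs V u. mu_shift x s z (V - {u, v})) = (\<Sum>v\<in>nbrs V u. mu_at x (V - {u, v}))
          + z * (\<Sum>v\<in>nbrs (V - {s}) u. mu_at x (V - {s} - {u, v}))"
        using N V by (auto simp: mu_shift_def sum.distrib sum_distrib_left)
      show ?thesis unfolding 3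
        using True False by (simp add: mu_shift_def 1 2 algebra_simps)
    next
      case False': False
      have "s \<notin> V - {u}" "\<And>v. s \<notin> V - {u, v}" using False' by auto
      then show ?thesis using False False' rec[OF V] by (simp add: mu_shift_def)
    qed
  qed
qed

text \<open>The expression is quadratic in \<open>z\<close>. Its outer coefficients are themselves
  Rayleigh differences, so nonnegativity for all \<open>z\<close> controls the mixed middle
  coefficient.\<close>

lemma rayleigh_mu_shift:
  assumes "s \<in> V" "s \<noteq> w" "s \<noteq> v"
  shows "rayleigh (mu_shift x s z) V w v = rayleigh (mu_at x) V w v
    + z * (mu_at x (V - {w}) * mu_at x (V - {s, v}) + mu_at x (V - {s, w}) * mu_at x (V - {v})
          - mu_at x V * mu_at x (V - {s, w, v}) - mu_at x (V - {s}) * mu_at x (V - {w, v}))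
    + z\<^sup>2 * rayleigh (mu_at x) (V - {s}) w v"
proof -
  have "V - {w} - {s} = V - {s, w}" "V - {v} - {s} = V - {s, v}" "V - {w, v} - {s} = V - {s, w, v}"
    "V - {s} - {w} = V - {s, w}" "V - {s} - {v} = V - {s, v}" "V - {s} - {w, v} = V - {s, w, v}"
    by auto
  then show ?thesis using assms
    by (simp add: rayleigh_def mu_shift_def algebra_simps power2_eq_square)
qed

lemma pderiv_sum: "pderiv (sum f A) = (\<Sum>a\<in>A. pderiv (f a))"
  by (induction A rule: infinite_finite_induct) (simp_all add: pderiv_add)

text \<open>Differentiate the recurrence at \<open>u\<close> and apply induction to the smaller
  sets; the result regroups into the recurrences at \<open>u\<close> for the sets
  \<open>V - {w}\<close>.\<close>

lemma pderiv_mu: "finite V \<Longrightarrow> pderiv (mu V) = (\<Sum>u\<in>V. mu (V - {u}))"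
proof (induction V rule: finite_psubset_induct)
  case (psubset V)
  show ?case
  proof (cases "V = {}")
    case False
    then obtain u where u: "u \<in> V" by blast
    note V = psubset.hyps
    have IH: "pderiv (mu W) = (\<Sum>w\<in>W. mu (W - {w}))" if "W \<subseteq> V - {u}" for W
      using that u by (intro psubset.IH) auto
    have "pderiv (mu V) = mu (V - {u}) + [:0, 1:] * pderiv (mu (V - {u})) - (\<Sum>v\<in>nbrs V u. pderiv (mu (V - {u, v})))"
      unfolding mu_rec[OF V u]
      by (simp add: pderiv_diff pderiv_mult pderiv_pCons pderiv_sum)
    also have "pderiv (mu (V - {u})) = (\<Sum>w\<in>V - {u}. mu (V - {u} - {w}))" by (rule IH) auto
    also have "(\<Sum>v\<in>nbrs V u. pderiv (mu (V - {u, v}))) = (\<Sum>v\<in>nbrs V u. \<Sum>w\<in>V - {u, v}. mu (V - {u, v} - {w}))"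
      by (intro sum.cong IH refl) auto
    also have "\<dots> = (\<Sum>(v, w)\<in>Sigma (nbrs V u) (\<lambda>v. V - {u, v}). mu (V - {u, v} - {w}))"
      using V by (simp add: sum.Sigma)
    \<comment> \<open>Exchange of summation over ordered pairs of distinct vertices
      \<open>v\<close>, \<open>w\<close> other than \<open>u\<close>, with \<open>v\<close> adjacent
      to \<open>u\<close>.\<close>
    also have "\<dots> = (\<Sum>(w, v)\<in>Sigma (V - {u}) (\<lambda>w. nbrs (V - {w}) u). mu (V - {w} - {u, v}))"
      by (rule sum.reindex_bij_witness[of _ prod.swap prod.swap])
         (auto simp: nbrs_def dest: edge_neq intro!: arg_cong[of _ _ mu])
    also have "\<dots> = (\<Sum>w\<in>V - {u}. \<Sum>v\<in>nbrs (V - {w}) u. mu (V - {w} - {u, v}))"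
      using V by (simp add: sum.Sigma)
    finally have "pderiv (mu V) = mu (V - {u}) + (\<Sum>w\<in>V - {u}. [:0, 1:] * mu (V - {u} - {w}) - (\<Sum>v\<in>nbrs (V - {w}) u. mu (V - {w} - {u, v})))"
      by (simp only: sum_subtractf sum_distrib_left add_diff_eq)
    also have "(\<Sum>w\<in>V - {u}. [:0, 1:] * mu (V - {u} - {w}) - (\<Sum>v\<in>nbrs (V - {w}) u. mu (V - {w} - {u, v})))
        = (\<Sum>w\<in>V - {u}. mu (V - {w}))"
    proof (rule sum.cong[OF refl])
      fix w assume w: "w \<in> V - {u}"
      have "V - {w} - {u} = V - {u} - {w}" "u \<in> V - {w}" using u w by auto
      then show "[:0, 1:] * mu (V - {u} - {w}) - (\<Sum>v\<in>nbrs (V - {w}) u. mu (V - {w} - {u, v})) = mu (V - {w})"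
        using mu_rec[of "V - {w}" u] V by simp
    qed
    finally show ?thesis by (simp only: sum.remove[OF V u])
  qed simp
qed

subsection \<open>Root multiplicities\<close>

definition wronsk :: "'a set \<Rightarrow> 'a \<Rightarrow> real poly" where
  "wronsk V u = pderiv (mu V) * mu (V - {u}) - mu V * pderiv (mu (V - {u}))"

text \<open>The derivative formula turns the Wronskian into the square of
  \<open>mu (V - {u})\<close> plus Rayleigh differences, which are nonnegative.\<close>

lemma wronsk_ge:
  assumes V: "finite V" "u \<in> V"
  shows "(mu_at x (V - {u}))\<^sup>2 \<le> poly (wronsk V u) x"
proof -
  have "wronsk V u = (mu (V - {u}))\<^sup>2 + (\<Sum>v\<in>V - {u}. rayleigh mu V u v)"
  proof -
    have "V - {u} - {v} = V - {u, v}" for v by auto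
    then show ?thesis
      unfolding wronsk_def pderiv_mu[OF V(1)] pderiv_mu[OF finite_Diff[OF V(1)]] sum.remove[OF V]
      by (simp add: rayleigh_def sum_subtractf sum_distrib_left sum_distrib_right algebra_simps power2_eq_square)
  qed
  moreover have "0 \<le> (\<Sum>v\<in>V - {u}. rayleigh (mu_at x) V u v)"
    using V by (intro sum_nonneg rayleigh_nonneg[OF weighted_mu_at]) auto
  ultimately show ?thesis by (simp add: poly_sum poly_rayleigh mu_at_def)
qed

end

locale edge_set_root = edge_set E for E :: "'a set set" +
  fixes \<theta> :: real
begin

abbreviation dv :: "nat \<Rightarrow> real poly \<Rightarrow> bool" where
  "dv n p \<equiv> [:-\<theta>, 1:] ^ n dvd p"

definition mult_in :: "'a set \<Rightarrow> nat" where "mult_in V = order \<theta> (mu V)"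

lemma dv_mono: "n \<le> k \<Longrightarrow> dv k p \<Longrightarrow> dv n p"
  by (meson dvd_trans le_imp_power_dvd)

lemma dv_mu: "finite V \<Longrightarrow> dv n (mu V) \<longleftrightarrow> n \<le> mult_in V"
  by (simp add: order_divides mult_in_def)

lemma dv_mu_mult: "finite V \<Longrightarrow> finite W \<Longrightarrow> dv n (mu V * mu W) \<longleftrightarrow> n \<le> mult_in V + mult_in W"
  by (simp add: order_divides mult_in_def order_mult)

lemma dv_pderiv:
  assumes "dv (Suc n) p" shows "dv n (pderiv p)"
proof -
  obtain q where "p = [:-\<theta>, 1:] ^ Suc n * q" using assms by blast
  then have "pderiv p = [:-\<theta>, 1:] ^ n * ([:-\<theta>, 1:] * pderiv q + smult (of_nat (Suc n)) q)"
    by (simp only: pderiv_mult pderiv_power_Suc) (simp add: algebra_simps pderiv_pCons)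
  then show ?thesis by simp
qed

text \<open>With \<open>k\<close> the multiplicity after deletion, multiplicity \<open>k + 2\<close>
  before it would make the Wronskian divisible to order \<open>2 * k + 1\<close>, although it
  dominates a square of order exactly \<open>2 * k\<close>.\<close>

lemma interlace_le:
  assumes V: "finite V" "u \<in> V"
  shows "mult_in V \<le> Suc (mult_in (V - {u}))"
proof (rule ccontr)
  let ?k = "mult_in (V - {u})"
  assume "\<not> ?thesis"
  then have 1: "dv (Suc (Suc ?k)) (mu V)" using V by (simp add: dv_mu del: power_Suc)
  have 2: "dv ?k (mu (V - {u}))" using V by (simp add: dv_mu)
  have "dv (Suc ?k + ?k) (pderiv (mu V) * mu (V - {u}))"
    unfolding power_add by (intro mult_dvd_mono dv_pderiv 1 2)
  moreover have "dv (Suc ?k + ?k) (mu V * pderiv (mu (V - {u})))"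
  \<comment> \<open>For \<open>?k = 0\<close> the derivative supplies no power, and the factor
    \<open>mu V\<close> alone suffices.\<close>
  proof (cases ?k)
    case 0
    then show ?thesis using dv_mono[OF _ 1, of 1] by simp
  next
    case (Suc k')
    then have "dv (Suc (Suc ?k) + k') (mu V * pderiv (mu (V - {u})))"
      unfolding power_add using 2 by (intro mult_dvd_mono dv_pderiv 1) simp
    then show ?thesis using Suc by simp
  qed
  ultimately have "dv (Suc ?k + ?k) (wronsk V u)"
    unfolding wronsk_def by (rule dvd_diff)
  then have "dv (Suc ?k + ?k) (mu (V - {u}) * mu (V - {u}))"
    using wronsk_ge[OF V]
    by (intro power_dvd_nonneg_le[where p = "mu (V - {u}) * mu (V - {u})" and r = "wronsk V u"])
       (simp_all add: mu_at_def power2_eq_square)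
  then show False using V by (simp add: dv_mu_mult del: power_Suc)
qed

text \<open>By \<open>interlace_le\<close>, every term of the recurrence at \<open>u\<close> is
  divisible to order one less than the multiplicity of \<open>V - {u}\<close>.\<close>

lemma interlace_ge:
  assumes V: "finite V" "u \<in> V"
  shows "mult_in (V - {u}) \<le> Suc (mult_in V)"
proof -
  let ?k = "mult_in (V - {u}) - 1"
  have "dv ?k (mu (V - {u, v}))" if "v \<in> nbrs V u" for v
  proof -
    have v: "v \<in> V - {u}" "V - {u, v} = V - {u} - {v}"
      using that edge_neq by (auto simp: nbrs_def)
    then show ?thesis using interlace_le[of "V - {u}" v] V by (simp add: dv_mu)
  qed
  then have "dv ?k (mu V)"
    unfolding mu_rec[OF V] using V by (intro dvd_diff dvd_mult dvd_sum) (auto simp: dv_mu)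
  then show ?thesis using V by (simp add: dv_mu)
qed

lemma interlace2:
  assumes "finite V" "u \<in> V" "v \<in> V" "u \<noteq> v"
  shows "mult_in (V - {u, v}) \<le> Suc (mult_in (V - {u}))" "mult_in (V - {u}) \<le> Suc (mult_in (V - {u, v}))"
    "mult_in (V - {u, v}) \<le> Suc (mult_in (V - {v}))" "mult_in (V - {v}) \<le> Suc (mult_in (V - {u, v}))"
proof -
  have "V - {u, v} = V - {u} - {v}" "V - {v} - {u} = V - {u} - {v}" by auto
  then show "mult_in (V - {u, v}) \<le> Suc (mult_in (V - {u}))" "mult_in (V - {u}) \<le> Suc (mult_in (V - {u, v}))"
    "mult_in (V - {u, v}) \<le> Suc (mult_in (V - {v}))" "mult_in (V - {v}) \<le> Suc (mult_in (V - {u, v}))"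
    using interlace_le[of "V - {u}" v] interlace_ge[of "V - {u}" v]
      interlace_le[of "V - {v}" u] interlace_ge[of "V - {v}" u] assms by auto
qed

text \<open>Otherwise the derivative, a sum of the \<open>mu (V - {u})\<close>, would vanish at the
  root to the full order of \<open>mu V\<close> instead of one less.\<close>

lemma exists_essential:
  assumes V: "finite V" and "mult_in V \<noteq> 0"
  shows "\<exists>u\<in>V. mult_in V = Suc (mult_in (V - {u}))"
proof (rule ccontr)
  assume neg: "\<not> ?thesis"
  have "dv (mult_in V) (mu (V - {u}))" if "u \<in> V" for u
    using neg that interlace_le[OF V that] V by (auto simp: dv_mu le_Suc_eq)
  then have dv: "dv (mult_in V) (pderiv (mu V))"
    unfolding pderiv_mu[OF V] by (intro dvd_sum)
  have "pderiv (mu V) \<noteq> 0"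
  proof
    assume "pderiv (mu V) = 0"
    then obtain c where "mu V = [:c:]" using pderiv_iszero by blast
    then show False using assms mu_nz[OF V] by (simp add: mult_in_def order_0I)
  qed
  then show False
    using dv assms order_pderiv[of "mu V" \<theta>] mu_nz[OF V] by (simp add: order_divides mult_in_def order_root)
qed

lemma rayleigh_mu_nonneg:
  assumes "finite V" "u \<in> V" "v \<in> V" "u \<noteq> v"
  shows "0 \<le> poly (rayleigh mu V u v) x"
  using rayleigh_nonneg[OF weighted_mu_at assms] by (simp add: poly_rayleigh)

lemma rayleigh_dvdI:
  assumes "finite V" "n \<le> mult_in (V - {u}) + mult_in (V - {v})" "n \<le> mult_in V + mult_in (V - {u, v})"
  shows "dv n (rayleigh mu V u v)"
  using assms unfolding rayleigh_def by (intro dvd_diff) (simp_all add: dv_mu_mult)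

lemma rayleigh_dvd:
  assumes "finite V" "dv n (rayleigh mu V u v)"
  shows "n \<le> mult_in (V - {u}) + mult_in (V - {v}) \<longleftrightarrow> n \<le> mult_in V + mult_in (V - {u, v})"
proof -
  have "dv n (mu (V - {u}) * mu (V - {v})) \<longleftrightarrow> dv n (mu V * mu (V - {u, v}))"
    using assms(2) unfolding rayleigh_def by (metis dvd_diff_right_iff dvd_diff_left_iff)
  then show ?thesis using assms(1) by (simp add: dv_mu_mult)
qed

lemma rayleigh_dvd_Suc:
  assumes "finite V" "u \<in> V" "v \<in> V" "u \<noteq> v" "dv n (rayleigh mu V u v)" "odd n"
  shows "dv (Suc n) (rayleigh mu V u v)"
  using assms by (intro power_dvd_nonneg_even rayleigh_mu_nonneg)

text \<open>If the smaller order of the two products is odd, the orders agree: otherwise their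
  difference would have exactly that odd order, impossible for a nonnegative polynomial.\<close>

lemma rayleigh_parity:
  assumes V: "finite V" "u \<in> V" "v \<in> V" "u \<noteq> v"
    and "odd n" "n = mult_in (V - {u}) + mult_in (V - {v}) \<or> n = mult_in V + mult_in (V - {u, v})"
    and "n \<le> mult_in (V - {u}) + mult_in (V - {v})" "n \<le> mult_in V + mult_in (V - {u, v})"
  shows "mult_in (V - {u}) + mult_in (V - {v}) = mult_in V + mult_in (V - {u, v})"
proof -
  have "dv (Suc n) (rayleigh mu V u v)"
    using assms by (intro rayleigh_dvd_Suc rayleigh_dvdI)
  from rayleigh_dvd[OF V(1) this] show ?thesis using assms(6-) by linarith
qed

lemma rayleigh_dvd_edge:
  assumes "finite V" "u \<in> V" "v \<in> V" "{u, v} \<in> E" "dv n (rayleigh mu V u v)"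
  shows "n \<le> 2 * mult_in (V - {u, v})"
proof -
  have "dv n (mu (V - {u, v}) * mu (V - {u, v}))"
    using assms(5) rayleigh_ge_edge[OF weighted_mu_at assms(1-4)]
    by (intro power_dvd_nonneg_le[where p = "mu (V - {u, v}) * mu (V - {u, v})" and r = "rayleigh mu V u v"])
       (simp_all add: mu_at_def power2_eq_square poly_rayleigh)
  then show ?thesis using assms(1) by (simp add: dv_mu_mult)
qed

lemma rayleigh_dvd_step:
  assumes "finite V" "u \<in> V" "v \<in> V" "u \<noteq> v" "w \<in> V" "w \<noteq> v" "{u, w} \<in> E" "dv n (rayleigh mu V u v)"
  shows "dv n (rayleigh mu (V - {u}) w v)"
proof -
  have "w \<noteq> u" using assms edge_neq by blast
  then show ?thesis
    using assms(8) rayleigh_ge_step[OF weighted_mu_at assms(1-7)] assms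
    by (intro power_dvd_nonneg_le[where p = "rayleigh mu (V - {u}) w v" and r = "rayleigh mu V u v"] rayleigh_mu_nonneg)
       (simp_all add: poly_rayleigh)
qed

text \<open>If no neighbour lowers the multiplicity m of \<open>V - {u}\<close>, the recurrence
  forces order at least m on \<open>mu V\<close>. Conversely, if \<open>u\<close> is not positive,
  the Rayleigh difference for a lowering neighbour has order at least 2m - 1, but
  \<open>rayleigh_dvd_edge\<close> allows at most 2m - 2.\<close>

lemma positive_iff:
  assumes V: "finite V" "u \<in> V"
  shows "mult_in (V - {u}) = Suc (mult_in V) \<longleftrightarrow> (\<exists>v\<in>nbrs V u. mult_in (V - {u}) = Suc (mult_in (V - {u, v})))"
proof
  assume pos: "mult_in (V - {u}) = Suc (mult_in V)"
  show "\<exists>v\<in>nbrs V u. mult_in (V - {u}) = Suc (mult_in (V - {u, v}))"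
  proof (rule ccontr)
    assume neg: "\<not> ?thesis"
    have "dv (mult_in (V - {u})) (mu (V - {u, v}))" if "v \<in> nbrs V u" for v
    proof -
      have v: "v \<in> V" "u \<noteq> v" using that edge_neq by (auto simp: nbrs_def)
      then show ?thesis using neg that interlace2[of V u v] V by (auto simp: dv_mu le_Suc_eq)
    qed
    then have "dv (mult_in (V - {u})) (mu V)"
      unfolding mu_rec[OF V] using V by (intro dvd_diff dvd_mult dvd_sum) (auto simp: dv_mu)
    then show False using V pos by (simp add: dv_mu del: power_Suc)
  qed
next
  assume "\<exists>v\<in>nbrs V u. mult_in (V - {u}) = Suc (mult_in (V - {u, v}))"
  then obtain v where v: "v \<in> V" "{u, v} \<in> E" "u \<noteq> v" "mult_in (V - {u}) = Suc (mult_in (V - {u, v}))"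
    using edge_neq by (auto simp: nbrs_def)
  show "mult_in (V - {u}) = Suc (mult_in V)"
  proof (rule ccontr)
    assume "\<not> ?thesis"
    then have "mult_in (V - {u}) \<le> mult_in V" using interlace_ge[OF V] by simp
    then have "dv (2 * mult_in (V - {u}) - 1) (rayleigh mu V u v)"
      using V v interlace_le[of V v] by (intro rayleigh_dvdI) auto
    then show False using rayleigh_dvd_edge[of V u v] V v by fastforce
  qed
qed

text \<open>With k the multiplicity of \<open>V - {w}\<close>, the product over the single deletions
  has odd order 2k + 1, so parity fixes the order of the other product.\<close>

lemma neutral_essential:
  assumes V: "finite V" "u \<in> V" "w \<in> V" "u \<noteq> w"
    and "mult_in (V - {u}) = mult_in V" "mult_in V = Suc (mult_in (V - {w}))"
  shows "mult_in (V - {u, w}) = mult_in (V - {w})"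
proof -
  have "mult_in V \<le> Suc (mult_in (V - {u, w}))" using interlace2[of V u w] assms by simp
  then show ?thesis
    using rayleigh_parity[OF V, of "2 * mult_in (V - {w}) + 1"] assms(5,6) by simp
qed

text \<open>Were \<open>u\<close> neutral, \<open>neutral_essential\<close> would give the Rayleigh
  difference order at least 2k + 1, with k the multiplicity of \<open>V - {w}\<close>; the edge
  \<open>{u, w}\<close> bounds it by 2k.\<close>

lemma special_positive:
  assumes V: "finite V" "u \<in> V" "w \<in> V" "{u, w} \<in> E"
    and u: "mult_in V \<le> mult_in (V - {u})" and w: "mult_in V = Suc (mult_in (V - {w}))"
  shows "mult_in (V - {u}) = Suc (mult_in V)"
proof (rule ccontr)
  assume "\<not> ?thesis"
  then have eq: "mult_in (V - {u}) = mult_in V" using u interlace_ge[OF V(1,2)] by simp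
  have "u \<noteq> w" using V edge_neq by blast
  then have x: "mult_in (V - {u, w}) = mult_in (V - {w})" using neutral_essential V eq w by blast
  have "dv (2 * mult_in (V - {w}) + 1) (rayleigh mu V u w)"
    using V eq x w by (intro rayleigh_dvdI) auto
  then show False using rayleigh_dvd_edge[OF V] x by fastforce
qed


lemma dv_square: "dv (2 * n) (p\<^sup>2) \<longleftrightarrow> dv n p"
  by (cases "p = 0") (auto simp: order_divides power2_eq_square order_mult)

text \<open>Perturbing the weight of \<open>s\<close> by \<open>z\<close> preserves nonnegativity,
  so the quadratic in \<open>z\<close> has nonpositive discriminant. The square of the middle
  coefficient is thus dominated by four times the product of the outer ones.\<close>

lemma cross_term_dvd:
  assumes V: "finite V" "s \<in> V" "w \<in> V" "v \<in> V" "s \<noteq> w" "s \<noteq> v" "w \<noteq> v"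
    and 1: "dv n (rayleigh mu V w v)" and 2: "dv n (rayleigh mu (V - {s}) w v)"
  shows "dv n (mu (V - {w}) * mu (V - {s, v}) + mu (V - {s, w}) * mu (V - {v})
      - mu V * mu (V - {s, w, v}) - mu (V - {s}) * mu (V - {w, v}))" (is "dv n ?b")
proof -
  have "(poly ?b x)\<^sup>2 \<le> 4 * poly (rayleigh mu V w v) x * poly (rayleigh mu (V - {s}) w v) x" for x
  proof (rule discriminant_le)
    show "0 \<le> poly (rayleigh mu (V - {s}) w v) x" using V by (intro rayleigh_mu_nonneg) auto
    have "0 \<le> rayleigh (mu_shift x s z) V w v" for z
      using V by (intro rayleigh_nonneg[OF weighted_mu_shift]) auto
    then show "0 \<le> poly (rayleigh mu V w v) x + z * poly ?b x + z\<^sup>2 * poly (rayleigh mu (V - {s}) w v) x" for z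
      unfolding rayleigh_mu_shift[OF V(2,5,6)] by (simp add: poly_rayleigh mu_at_def)
  qed
  moreover have "dv (2 * n) (smult 4 (rayleigh mu V w v * rayleigh mu (V - {s}) w v))"
    unfolding mult_2 power_add by (intro dvd_smult mult_dvd_mono 1 2)
  ultimately have "dv (2 * n) (?b\<^sup>2)"
    by (intro power_dvd_nonneg_le[where p = "?b\<^sup>2" and r = "smult 4 (rayleigh mu V w v * rayleigh mu (V - {s}) w v)"])
       (simp_all add: mult.assoc)
  then show ?thesis by (simp only: dv_square)
qed

subsection \<open>Stability and Gallai's lemma\<close>

text \<open>Deleting a special vertex shifts all multiplicities alike and so preserves the type of
  every other vertex. Parity and interlacing settle all cases except \<open>v\<close> positive with
  \<open>mult_in (V - {s, v}) = Suc k\<close>, which the discriminant excludes.\<close>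

lemma stability:
  assumes V: "finite V" "s \<in> V" "w \<in> V" "{s, w} \<in> E"
    and s: "mult_in V \<le> mult_in (V - {s})" and w: "mult_in V = Suc (mult_in (V - {w}))"
    and v: "v \<in> V" "v \<noteq> s"
  shows "mult_in (V - {s, v}) = Suc (mult_in (V - {v}))"
proof -
  define k where "k = mult_in (V - {w})"
  have sw: "s \<noteq> w" using V edge_neq by blast
  have mV: "mult_in V = Suc k" using w by (simp add: k_def)
  have ms: "mult_in (V - {s}) = Suc (Suc k)" using special_positive[OF V s w] mV by simp
  note bounds = interlace2[OF V(1,2) v(1) v(2)[symmetric]]
  have v_bounds: "mult_in (V - {v}) \<le> Suc (Suc k)" "k \<le> mult_in (V - {v})"
    using interlace_le[OF V(1) v(1)] interlace_ge[OF V(1) v(1)] mV by auto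
  show ?thesis
  proof (cases "mult_in (V - {s, v}) = Suc k")
    case False
    \<comment> \<open>The two sides would be \<open>2 * k + 4\<close> and \<open>2 * k + 3\<close>,
      whereas an odd minimum forces equality.\<close>
    have "mult_in (V - {v}) + Suc (Suc k) = Suc k + mult_in (V - {s, v})"
      if "mult_in (V - {v}) = Suc (Suc k)" "mult_in (V - {s, v}) = Suc (Suc k)"
      using rayleigh_parity[OF V(1,2) v(1) v(2)[symmetric], of "2 * k + 3"] ms mV that by simp
    then show ?thesis using bounds v_bounds False ms by linarith
  next
    case msv: True
    show ?thesis
    proof (cases "mult_in (V - {v}) = k")
      case True
      then show ?thesis using msv by simp
    next
      case False
      then have vw: "v \<noteq> w" by (auto simp: k_def)
      have D: "V - {v} - {s} = V - {s, v}" "V - {v} - {w} = V - {w, v}" "V - {v, w} = V - {w, v}"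
        "V - {w} - {s} = V - {s, w}" "V - {w} - {v} = V - {w, v}" "V - {w} - {s, v} = V - {s, w, v}"
        "V - {s} - {w} = V - {s, w}" "V - {s} - {v} = V - {s, v}" "V - {s} - {w, v} = V - {s, w, v}"
        by auto
      show ?thesis
      proof (cases "mult_in (V - {v}) = Suc k")
        case True
        \<comment> \<open>For neutral \<open>v\<close>, \<open>w\<close> remains essential in
          \<open>V - {v}\<close>, so \<open>s\<close> is positive there, against the assumed value
          of \<open>mult_in (V - {s, v})\<close>.\<close>
        have "mult_in (V - {v, w}) = k"
          using neutral_essential[of V v w] V v True w vw mV k_def by simp
        then show ?thesis
          using special_positive[of "V - {v}" s w] V v vw True msv sw by (simp add: D)
      next
        case not_neutral: False
        then have mv: "mult_in (V - {v}) = Suc (Suc k)" using v_bounds \<open>mult_in (V - {v}) \<noteq> k\<close> by linarith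
        have mwv: "mult_in (V - {w, v}) = Suc k"
          using interlace2[OF V(1,3) v(1) vw[symmetric]] mv k_def by simp
        have msw: "mult_in (V - {s, w}) = Suc k"
          using interlace2[OF V(1-3) sw] ms k_def by simp
        have d: "dv (2 * Suc k) (rayleigh mu V w v)"
          using V mV mv mwv k_def by (intro rayleigh_dvdI) auto
        \<comment> \<open>Moving along this edge transfers the order to the pair \<open>s\<close>,
          \<open>v\<close> in \<open>V - {w}\<close>; as \<open>mult_in (V - {w}) = k\<close>, the
          other factor must have order at least \<open>k + 2\<close>.\<close>
        have "{w, s} \<in> E" using V(4) by (simp add: insert_commute)
        then have "dv (2 * Suc k) (rayleigh mu (V - {w}) s v)"
          using rayleigh_dvd_step[OF V(1,3) v(1) vw[symmetric] V(2) v(2)[symmetric] _ d] by blast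
        then have mswv: "Suc (Suc k) \<le> mult_in (V - {s, w, v})"
          using rayleigh_dvd[of "V - {w}" "2 * Suc k" s v] V msw mwv k_def by (simp add: D)
        have d': "dv (2 * Suc k) (rayleigh mu (V - {s}) w v)"
          using V ms msw msv mswv by (intro rayleigh_dvdI) (auto simp: D)
        \<comment> \<open>The quadratic \<open>z\<close>-polynomial has outer coefficients of order at least \<open>2 * Suc k\<close>,
          hence so has its middle coefficient; but there only \<open>?a\<close> has smaller order.\<close>
        let ?a = "mu (V - {w}) * mu (V - {s, v})"
        let ?b = "mu (V - {s, w}) * mu (V - {v})" and ?c = "mu V * mu (V - {s, w, v})"
          and ?d = "mu (V - {s}) * mu (V - {w, v})"
        have e: "dv (2 * Suc k) (?a + ?b - ?c - ?d)"
          using cross_term_dvd[OF V(1,2,3) v(1) sw v(2)[symmetric] vw[symmetric] d d'] .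
        have b: "dv (2 * Suc k) ?b" and c: "dv (2 * Suc k) ?c" and d: "dv (2 * Suc k) ?d"
          using V(1) msw mv mV mswv ms mwv by (simp_all add: dv_mu_mult del: power_Suc)
        have "dv (2 * Suc k) (?a + ?b - ?c - ?d - ?b + ?c + ?d)"
          by (rule dvd_add[OF dvd_add[OF dvd_diff[OF e b] c] d])
        then have "dv (2 * Suc k) ?a" by simp
        then show ?thesis using V(1) msv k_def by (simp add: dv_mu_mult del: power_Suc)
      qed
    qed
  qed
qed

text \<open>Connectedness enters as an edge leaving every proper nonempty subset; it is applied to
  the set of vertices essential after deleting \<open>u\<close>.\<close>

lemma gallai:
  assumes V: "finite V" "V \<noteq> {}"
    and conn: "\<And>R. R \<noteq> {} \<Longrightarrow> R \<subset> V \<Longrightarrow> \<exists>x\<in>V - R. \<exists>y\<in>R. {x, y} \<in> E"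
    and ess: "\<And>u. u \<in> V \<Longrightarrow> mult_in V = Suc (mult_in (V - {u}))"
  shows "mult_in V = 1"
proof (rule ccontr)
  assume neg: "mult_in V \<noteq> 1"
  \<comment> \<open>A vertex special in \<open>V - {u}\<close> would, by stability, yield a neighbour of \<open>u\<close> that is
    essential in \<open>V - {u}\<close>; but adjacent essential vertices exclude that.\<close>
  obtain u where u: "u \<in> V" using V by blast
  define R where "R = {w \<in> V - {u}. mult_in (V - {u}) = Suc (mult_in (V - {u, w}))}"
  have D: "V - {u} - {w} = V - {u, w}" for w by auto
  have "mult_in (V - {u}) \<noteq> 0" using ess[OF u] neg by simp
  then obtain w where "w \<in> V - {u}" "mult_in (V - {u}) = Suc (mult_in (V - {u, w}))"
    using exists_essential[of "V - {u}"] V by (auto simp: D)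
  then have "R \<noteq> {}" by (auto simp: R_def)
  moreover have "R \<subset> V" using u by (auto simp: R_def)
  ultimately obtain x y where x: "x \<in> V" "x \<notin> R" and y: "y \<in> R" and xy: "{x, y} \<in> E"
    using conn by blast
  have nb: "v \<notin> R" if v: "{u, v} \<in> E" for v
  proof
    assume "v \<in> R"
    then have m: "v \<in> V" "mult_in (V - {u}) = Suc (mult_in (V - {u, v}))" by (auto simp: R_def)
    then have "dv (2 * mult_in (V - {u})) (rayleigh mu V u v)"
      using V ess[OF u] ess[OF m(1)] by (intro rayleigh_dvdI) auto
    then show False using rayleigh_dvd_edge[OF V(1) u m(1) v] m(2) by fastforce
  qed
  have xu: "x \<noteq> u" using nb xy y by auto
  have x': "mult_in (V - {u}) \<le> mult_in (V - {u} - {x})"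
    using x xu interlace_le[of "V - {u}" x] V by (auto simp: R_def D le_Suc_eq)
  have y': "y \<in> V - {u}" "mult_in (V - {u}) = Suc (mult_in (V - {u} - {y}))"
    using y by (auto simp: R_def D)
  \<comment> \<open>\<open>x\<close> is special in \<open>V - {u}\<close>, hence positive there.
    Since deleting \<open>u\<close> and deleting \<open>x\<close> give equal multiplicities,
    \<open>u\<close> is positive in \<open>V - {x}\<close>.\<close>
  have "mult_in (V - {u} - {x}) = Suc (mult_in (V - {u}))"
    using x xu V y' x' xy by (intro special_positive[of _ _ y]) auto
  moreover have "V - {u} - {x} = V - {x} - {u}" by auto
  ultimately have "mult_in (V - {x} - {u}) = Suc (mult_in (V - {x}))"
    using ess[OF u] ess[OF x(1)] by simp
  then obtain v where v: "v \<in> nbrs (V - {x}) u" "mult_in (V - {x} - {u}) = Suc (mult_in (V - {x} - {u, v}))"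
    using positive_iff[of "V - {x}" u] V u xu by auto
  then have v': "v \<in> V" "v \<noteq> x" "v \<noteq> u" "{u, v} \<in> E" using edge_neq by (auto simp: nbrs_def)
  have "mult_in (V - {u} - {x, v}) = Suc (mult_in (V - {u} - {v}))"
    using x xu V y' x' xy v' by (intro stability[of _ _ y]) auto
  moreover have "V - {u} - {x, v} = V - {x} - {u, v}" by auto
  ultimately have "mult_in (V - {u}) = Suc (mult_in (V - {u, v}))"
    using v(2) ess[OF u] ess[OF x(1)] \<open>mult_in (V - {x} - {u}) = Suc (mult_in (V - {x}))\<close> by (simp add: D)
  then have "v \<in> R" using v' by (simp add: R_def)
  then show False using nb v' by blast
qed

section \<open>Disjoint unions, deletion of all special vertices, and joins\<close>

lemma mu_union:
  assumes "finite V" "finite W" "V \<inter> W = {}" "\<And>x y. x \<in> V \<Longrightarrow> y \<in> W \<Longrightarrow> {x, y} \<notin> E"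
  shows "mu (V \<union> W) = mu V * mu W"
  using assms
proof (induction V rule: finite_psubset_induct)
  case (psubset V)
  show ?case
  proof (cases "V = {}")
    case False
    then obtain u where u: "u \<in> V" by blast
    have IH: "mu ((V \<union> W) - X) = mu (V - X) * mu W" if "X \<subseteq> V" "X \<noteq> {}" for X
    proof -
      have "(V \<union> W) - X = (V - X) \<union> W" using that psubset.prems by auto
      then show ?thesis using that psubset.prems by (simp only:) (intro psubset.IH, auto)
    qed
    have N: "nbrs (V \<union> W) u = nbrs V u" using psubset.prems u by (auto simp: nbrs_def)
    have "mu (V \<union> W) = [:0, 1:] * mu ((V \<union> W) - {u}) - (\<Sum>v\<in>nbrs V u. mu ((V \<union> W) - {u, v}))"
      using mu_rec[of "V \<union> W" u] psubset u unfolding N by blast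
    also have "(\<Sum>v\<in>nbrs V u. mu ((V \<union> W) - {u, v})) = (\<Sum>v\<in>nbrs V u. mu (V - {u, v}) * mu W)"
      using u by (intro sum.cong refl IH) (auto simp: nbrs_def)
    also have "mu ((V \<union> W) - {u}) = mu (V - {u}) * mu W" using u by (intro IH) auto
    finally show ?thesis unfolding mu_rec[OF psubset.hyps u]
      by (simp add: algebra_simps sum_distrib_left)
  qed simp
qed

lemma mult_in_union:
  assumes "finite V" "finite W" "V \<inter> W = {}" "\<And>x y. x \<in> V \<Longrightarrow> y \<in> W \<Longrightarrow> {x, y} \<notin> E"
  shows "mult_in (V \<union> W) = mult_in V + mult_in W"
  using assms by (simp add: mult_in_def mu_union order_mult)

text \<open>Delete the vertices one at a time. Carrying the uniform shift of all single deletions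
  through the induction keeps the remaining members of \<open>A\<close> special, so that
  \<open>stability\<close> applies again.\<close>

lemma mult_in_delete_special:
  assumes V: "finite V" "A \<subseteq> V"
    and A: "\<And>a. a \<in> A \<Longrightarrow> mult_in V \<le> mult_in (V - {a})"
      "\<And>a. a \<in> A \<Longrightarrow> \<exists>w\<in>V. mult_in V = Suc (mult_in (V - {w})) \<and> {a, w} \<in> E"
  shows "mult_in (V - A) = mult_in V + card A \<and> (\<forall>v\<in>V - A. mult_in (V - A - {v}) = mult_in (V - {v}) + card A)"
proof -
  have "finite A" using V finite_subset by blast
  have "A' \<subseteq> A \<Longrightarrow> mult_in (V - A') = mult_in V + card A' \<and>
      (\<forall>v\<in>V - A'. mult_in (V - A' - {v}) = mult_in (V - {v}) + card A')" if "finite A'" for A'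
    using \<open>finite A'\<close>
  proof (induction A')
    case (insert a A')
    have IH: "mult_in (V - A') = mult_in V + card A'"
      "\<And>v. v \<in> V - A' \<Longrightarrow> mult_in (V - A' - {v}) = mult_in (V - {v}) + card A'"
      using insert by auto
    have a: "a \<in> V - A'" "a \<in> A" using insert V by auto
    obtain w where w: "w \<in> V" "mult_in V = Suc (mult_in (V - {w}))" "{a, w} \<in> E"
      using A(2)[OF a(2)] by blast
    \<comment> \<open>The essential neighbour lies outside \<open>A\<close>, so it survives every
      deletion.\<close>
    have "w \<notin> A" using A(1)[of w] w by auto
    then have w': "w \<in> V - A'" using w insert.prems by auto
    have s: "mult_in (V - A') \<le> mult_in (V - A' - {a})" "mult_in (V - A') = Suc (mult_in (V - A' - {w}))"
      using IH(1) IH(2)[OF a(1)] IH(2)[OF w'] A(1)[OF a(2)] w(2) by auto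
    have D: "V - insert a A' = V - A' - {a}" by auto
    have "mult_in (V - A' - {a}) = Suc (mult_in (V - A'))"
      using V a w w' s by (intro special_positive[of _ _ w]) auto
    moreover have "mult_in (V - A' - {a} - {v}) = mult_in (V - {v}) + card (insert a A')"
      if v: "v \<in> V - insert a A'" for v
    proof -
      have "mult_in (V - A' - {a, v}) = Suc (mult_in (V - A' - {v}))"
        using V a w w' s v by (intro stability[of _ _ w]) auto
      moreover have "V - A' - {a, v} = V - A' - {a} - {v}" by auto
      ultimately show ?thesis using IH(2)[of v] v insert by simp
    qed
    ultimately show ?case using IH(1) insert by (simp add: D)
  qed simp
  from this[OF \<open>finite A\<close> subset_refl] show ?thesis .
qed

text \<open>The vertices of \<open>A\<close> are added one by one. The bound on
  \<open>card A\<close> keeps the current multiplicity nonzero, so an essential vertex exists; the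
  new vertex is adjacent to it and hence positive by \<open>positive_iff\<close>.\<close>

lemma mult_in_join:
  assumes "finite A" "finite W" "A \<inter> W = {}"
    and "\<And>a z. a \<in> A \<Longrightarrow> z \<in> A \<union> W \<Longrightarrow> z \<noteq> a \<Longrightarrow> {a, z} \<in> E" and "card A \<le> mult_in W"
  shows "mult_in (A \<union> W) + card A = mult_in W"
  using assms
proof (induction A)
  case (insert a A)
  have IH: "mult_in (A \<union> W) + card A = mult_in W" using insert by (intro insert.IH) auto
  then have "mult_in (A \<union> W) \<noteq> 0" using insert by auto
  then obtain y where y: "y \<in> A \<union> W" "mult_in (A \<union> W) = Suc (mult_in (A \<union> W - {y}))"
    using exists_essential[of "A \<union> W"] insert by auto
  let ?V = "insert a A \<union> W"
  have D: "?V - {a} = A \<union> W" "?V - {a, y} = A \<union> W - {y}" using insert by auto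
  have "y \<in> nbrs ?V a" using y insert by (auto simp: nbrs_def)
  then have "mult_in (?V - {a}) = Suc (mult_in ?V)"
    using positive_iff[of ?V a] y insert D by auto
  then show ?case using IH insert D by simp
qed simp

end

subsection \<open>Components\<close>

definition reach :: "'a graph \<Rightarrow> 'a \<Rightarrow> 'a set" where
  "reach G u = {v. (adj G)\<^sup>*\<^sup>* u v}"

lemma adj_sym: "adj G u v \<Longrightarrow> adj G v u"
  by (simp add: adj_def insert_commute)

lemma reach_sym: "(adj G)\<^sup>*\<^sup>* u v \<Longrightarrow> (adj G)\<^sup>*\<^sup>* v u"
  by (induction rule: rtranclp_induct) (auto dest: adj_sym intro: converse_rtranclp_into_rtranclp)

lemma adj_induced: "adj (induced G C) u v \<longleftrightarrow> adj G u v \<and> u \<in> C \<and> v \<in> C"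
  by (simp add: adj_def induced_def edges_def)

lemma reach_subset:
  assumes "simple_graph G" "u \<in> verts G"
  shows "reach G u \<subseteq> verts G"
proof
  fix v assume "v \<in> reach G u"
  then have "(adj G)\<^sup>*\<^sup>* u v" by (simp add: reach_def)
  then show "v \<in> verts G"
    using assms by (induction) (auto simp: simple_graph_def adj_def doubleton_eq_iff)
qed

lemma reach_step: "x \<in> reach G u \<Longrightarrow> {x, y} \<in> edges G \<Longrightarrow> y \<in> reach G u"
  unfolding reach_def adj_def by (simp add: adj_def rtranclp.rtrancl_into_rtrancl)

lemma verts_induced [simp]: "verts (induced G C) = C"
  by (simp add: verts_def induced_def)

lemma connected_reach: "connected (induced G (reach G u))"
proof -
  let ?r = "(adj (induced G (reach G u)))\<^sup>*\<^sup>*"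
  have r: "?r u v" if "(adj G)\<^sup>*\<^sup>* u v" for v
    using that
  proof induction
    case (step y z)
    then have "adj (induced G (reach G u)) y z"
      by (auto simp: adj_induced reach_def intro: rtranclp.rtrancl_into_rtrancl)
    then show ?case using step by simp
  qed simp
  have "?r v w" if "v \<in> reach G u" "w \<in> reach G u" for v w
    using that reach_sym[OF r] r unfolding reach_def by (blast intro: rtranclp_trans)
  moreover have "u \<in> reach G u" by (simp add: reach_def)
  ultimately show ?thesis by (auto simp: connected_def)
qed

text \<open>Every connected induced subgraph containing \<open>u\<close> lies within
  \<open>reach G u\<close>, which is itself connected, so maximality leaves no other choice.\<close>

lemma component_of_iff:
  assumes "simple_graph G" "u \<in> verts G"
  shows "component_of H G \<and> u \<in> verts H \<longleftrightarrow> H = induced G (reach G u)"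
proof -
  have sub: "C \<subseteq> reach G u" if "connected (induced G C)" "u \<in> C" for C
  proof
    fix x assume "x \<in> C"
    then have "(adj (induced G C))\<^sup>*\<^sup>* u x" using that by (simp add: connected_def)
    then have "(adj G)\<^sup>*\<^sup>* u x"
      by (rule mono_rtranclp[rule_format, rotated]) (simp add: adj_induced)
    then show "x \<in> reach G u" by (simp add: reach_def)
  qed
  have u: "u \<in> reach G u" by (simp add: reach_def)
  show ?thesis
  proof
    assume "component_of H G \<and> u \<in> verts H"
    then obtain C where C: "H = induced G C" "connected H" "u \<in> C"
      "\<And>D. C \<subset> D \<and> D \<subseteq> verts G \<Longrightarrow> \<not> connected (induced G D)"
      by (auto simp: component_of_def)
    then show "H = induced G (reach G u)"
      using sub[of C] connected_reach[of G u] reach_subset[OF assms] by blast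
  next
    assume "H = induced G (reach G u)"
    then show "component_of H G \<and> u \<in> verts H"
      using sub u connected_reach[of G u] reach_subset[OF assms]
      unfolding component_of_def by (auto intro!: exI[of _ "reach G u"])
  qed
qed

text \<open>Turns connectedness by walks into the cut form used in \<open>gallai\<close>: a walk
  from inside \<open>R\<close> to outside must cross.\<close>

lemma connected_crossing_edge:
  assumes "connected (induced G C)" "R \<noteq> {}" "R \<subset> C"
  shows "\<exists>x\<in>C - R. \<exists>y\<in>R. {x, y} \<in> edges G"
proof (rule ccontr)
  assume neg: "\<not> ?thesis"
  obtain y x where "y \<in> R" "x \<in> C - R" using assms by blast
  then have "(adj (induced G C))\<^sup>*\<^sup>* y x" using assms by (auto simp: connected_def)
  then have "x \<in> R"
  proof induction
    case (step v w)
    then have "w \<in> C" "{w, v} \<in> edges G"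
      by (simp_all add: adj_induced) (simp add: adj_def insert_commute)
    then show ?case using neg step.IH by blast
  qed fact
  then show False using \<open>x \<in> C - R\<close> by blast
qed

section \<open>Critical components and the deletion of two vertices\<close>

context edge_set_root begin

lemma mult_del_induced:
  "mult \<theta> (del_verts (C, {e \<in> E. e \<subseteq> C}) X) = mult_in (C - X)"
proof -
  have "{e \<in> {e \<in> E. e \<subseteq> C}. e \<inter> X = {}} = {e \<in> E. e \<subseteq> C - X}" by auto
  then show ?thesis by (simp add: del_verts_def verts_def edges_def mult_in_def mult_def mu_def)
qed

lemma mult_induced: "mult \<theta> (C, {e \<in> E. e \<subseteq> C}) = mult_in C"
  by (simp add: mult_def mult_in_def mu_def)

context
  fixes W :: "'a set" and \<Gamma> :: "'a graph"
  assumes W: "finite W"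
  defines "\<Gamma> \<equiv> (W, {e \<in> E. e \<subseteq> W})"
begin

lemma simple_\<Gamma>: "simple_graph \<Gamma>"
  using W edgeE by (fastforce simp: simple_graph_def \<Gamma>_def verts_def edges_def)

lemma reach_\<Gamma>: "u \<in> W \<Longrightarrow> reach \<Gamma> u \<subseteq> W"
  using reach_subset[OF simple_\<Gamma>] by (simp add: \<Gamma>_def verts_def)

lemma induced_\<Gamma>: "C \<subseteq> W \<Longrightarrow> induced \<Gamma> C = (C, {e \<in> E. e \<subseteq> C})"
  by (auto simp: induced_def \<Gamma>_def edges_def)

text \<open>No edge leaves \<open>reach \<Gamma> u\<close>, so the matching polynomial factors;
  \<open>X\<close> and \<open>Y\<close> are the vertices deleted inside and outside the
  component.\<close>

lemma mult_in_component:
  assumes "u \<in> W" "X \<subseteq> reach \<Gamma> u" "Y \<inter> reach \<Gamma> u = {}"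
  shows "mult_in (W - (X \<union> Y)) = mult_in (reach \<Gamma> u - X) + mult_in (W - reach \<Gamma> u - Y)"
proof -
  let ?C = "reach \<Gamma> u"
  have C: "?C \<subseteq> W" using assms reach_\<Gamma> by blast
  have "mult_in ((?C - X) \<union> (W - ?C - Y)) = mult_in (?C - X) + mult_in (W - ?C - Y)"
  proof (rule mult_in_union)
    fix x y assume "x \<in> ?C - X" "y \<in> W - ?C - Y"
    then show "{x, y} \<notin> E"
      using C reach_step[of x \<Gamma> u y] by (auto simp: \<Gamma>_def edges_def)
  qed (use W C finite_subset in auto)
  moreover have "(?C - X) \<union> (W - ?C - Y) = W - (X \<union> Y)" using assms C by auto
  ultimately show ?thesis by simp
qed

text \<open>The contribution of the other components cancels, so essentiality in the component and
  in the whole graph coincide.\<close>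

lemma critical_component_iff:
  assumes "u \<in> W"
  shows "critical \<theta> (induced \<Gamma> (reach \<Gamma> u)) \<longleftrightarrow>
    (\<forall>x\<in>reach \<Gamma> u. mult_in W = Suc (mult_in (W - {x})))"
proof -
  let ?C = "reach \<Gamma> u"
  have "mult_in W = mult_in ?C + mult_in (W - ?C)"
    using mult_in_component[OF assms, of "{}" "{}"] by simp
  moreover have "mult_in (W - {x}) = mult_in (?C - {x}) + mult_in (W - ?C)" if "x \<in> ?C" for x
    using mult_in_component[OF assms, of "{x}" "{}"] that by simp
  ultimately have "essential \<theta> (induced \<Gamma> ?C) x \<longleftrightarrow> mult_in W = Suc (mult_in (W - {x}))" if "x \<in> ?C" for x
    using that by (auto simp: essential_def induced_\<Gamma>[OF reach_\<Gamma>[OF assms]] mult_del_induced mult_induced)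
  then show ?thesis using connected_reach[of \<Gamma> u] by (simp add: critical_def)
qed

context
  assumes no_special: "\<forall>x\<in>W. \<forall>y\<in>W. {x, y} \<in> E \<longrightarrow>
    mult_in W = Suc (mult_in (W - {y})) \<longrightarrow> mult_in W = Suc (mult_in (W - {x}))"
begin

lemma essential_component:
  assumes u: "u \<in> W" "mult_in W = Suc (mult_in (W - {u}))" and x: "x \<in> reach \<Gamma> u"
  shows "mult_in W = Suc (mult_in (W - {x}))"
proof -
  have "(adj \<Gamma>)\<^sup>*\<^sup>* u x" using x by (simp add: reach_def)
  then have "x \<in> W \<and> mult_in W = Suc (mult_in (W - {x}))"
  proof induction
    case (step y z)
    then have "z \<in> W" "{z, y} \<in> E" by (auto simp: adj_def \<Gamma>_def edges_def insert_commute)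
    then show ?case using step no_special by blast
  qed (use u in auto)
  then show ?thesis by blast
qed

lemma mult_in_essential_component:
  assumes u: "u \<in> W" "mult_in W = Suc (mult_in (W - {u}))"
  shows "mult_in (reach \<Gamma> u) = 1"
proof (rule gallai)
  let ?C = "reach \<Gamma> u"
  have C: "?C \<subseteq> W" using reach_\<Gamma> u by blast
  show "finite ?C" using C W finite_subset by blast
  show "?C \<noteq> {}" by (auto simp: reach_def)
  show "\<exists>x\<in>?C - R. \<exists>y\<in>R. {x, y} \<in> E" if "R \<noteq> {}" "R \<subset> ?C" for R
    using connected_crossing_edge[OF connected_reach that] by (auto simp: \<Gamma>_def edges_def)
  fix x assume x: "x \<in> ?C"
  show "mult_in ?C = Suc (mult_in (?C - {x}))"
    using essential_component[OF u x] x
      mult_in_component[OF u(1), of "{x}" "{}"] mult_in_component[OF u(1), of "{}" "{}"] by simp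
qed

text \<open>The component of \<open>u\<close> has multiplicity 1. If \<open>v\<close> lies in it,
  then \<open>v\<close> is essential and the component must drop to multiplicity 0; if not, deleting
  \<open>u\<close> already accounts for the loss of one and \<open>v\<close> must be
  neutral.\<close>

lemma two_deleted_essential:
  assumes u: "u \<in> W" "mult_in W = Suc (mult_in (W - {u}))" and v: "v \<in> W" "u \<noteq> v"
  shows "mult_in W = Suc (mult_in (W - {u, v})) \<longleftrightarrow> mult_in (W - {v}) = mult_in W \<or>
    v \<in> reach \<Gamma> u \<and> mult_in (reach \<Gamma> u - {u, v}) = 0"
proof -
  let ?C = "reach \<Gamma> u"
  have uC: "u \<in> ?C" by (simp add: reach_def)
  have 1: "mult_in W = 1 + mult_in (W - ?C)"
    using mult_in_component[OF u(1), of "{}" "{}"] mult_in_essential_component[OF u] by simp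
  show ?thesis
  proof (cases "v \<in> ?C")
    case True
    then have "mult_in (W - {u, v}) = mult_in (?C - {u, v}) + mult_in (W - ?C)"
      using mult_in_component[OF u(1), of "{u, v}" "{}"] uC by simp
    then show ?thesis using 1 True essential_component[OF u True] by simp
  next
    case False
    have "mult_in (W - {u, v}) = mult_in (?C - {u}) + mult_in (W - ?C - {v})"
      "mult_in (W - {v}) = mult_in ?C + mult_in (W - ?C - {v})"
      "mult_in (W - {u}) = mult_in (?C - {u}) + mult_in (W - ?C)"
      using mult_in_component[OF u(1), of "{u}" "{v}"] mult_in_component[OF u(1), of "{}" "{v}"]
        mult_in_component[OF u(1), of "{u}" "{}"] uC False by (simp_all add: insert_commute)
    then show ?thesis using 1 False u(2) mult_in_essential_component[OF u] by auto
  qed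
qed

lemma two_deleted:
  assumes uv: "u \<in> W" "v \<in> W" "u \<noteq> v"
  shows "mult_in W = Suc (mult_in (W - {u, v})) \<longleftrightarrow>
    (mult_in (W - {u}) = mult_in W \<and> mult_in W = Suc (mult_in (W - {v}))) \<or>
    (mult_in (W - {v}) = mult_in W \<and> mult_in W = Suc (mult_in (W - {u}))) \<or>
    (\<exists>H. component_of H \<Gamma> \<and> critical \<theta> H \<and> u \<in> verts H \<and> v \<in> verts H \<and>
       mult \<theta> (del_verts H {u, v}) = 0)" (is "_ \<longleftrightarrow> _ \<or> _ \<or> ?H")
proof -
  have H: "?H \<longleftrightarrow> (\<forall>x\<in>reach \<Gamma> u. mult_in W = Suc (mult_in (W - {x}))) \<and> v \<in> reach \<Gamma> u \<and>
      mult_in (reach \<Gamma> u - {u, v}) = 0"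
  proof -
    have "component_of H \<Gamma> \<and> u \<in> verts H \<longleftrightarrow> H = induced \<Gamma> (reach \<Gamma> u)" for H
      using component_of_iff[OF simple_\<Gamma>] uv(1) by (simp add: \<Gamma>_def verts_def)
    then have "?H \<longleftrightarrow> critical \<theta> (induced \<Gamma> (reach \<Gamma> u)) \<and> v \<in> reach \<Gamma> u \<and>
        mult \<theta> (del_verts (induced \<Gamma> (reach \<Gamma> u)) {u, v}) = 0"
      by (metis verts_induced)
    then show ?thesis
      unfolding critical_component_iff[OF uv(1)] unfolding induced_\<Gamma>[OF reach_\<Gamma>[OF uv(1)]] mult_del_induced .
  qed
  have uC: "u \<in> reach \<Gamma> u" by (simp add: reach_def)
  consider (u) "mult_in W = Suc (mult_in (W - {u}))" | (v) "mult_in W = Suc (mult_in (W - {v}))" "mult_in W \<noteq> Suc (mult_in (W - {u}))"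
    | (none) "mult_in W \<noteq> Suc (mult_in (W - {u}))" "mult_in W \<noteq> Suc (mult_in (W - {v}))"
    by blast
  then show ?thesis
  proof cases
    case u
    then show ?thesis
      using two_deleted_essential[OF uv(1) u uv(2,3)] essential_component[OF uv(1) u] H by auto
  next
    case v
    have "u \<notin> reach \<Gamma> v" using essential_component[OF uv(2) v(1)] v(2) by blast
    then show ?thesis
      using two_deleted_essential[OF uv(2) v(1) uv(1)] uv(3) H uC v by (auto simp: insert_commute)
  next
    case none
    \<comment> \<open>If neither vertex is essential, the single deletions have multiplicity sum at
      least 2m, m being that of \<open>W\<close>; the assumed equality would make the other sum the
      odd number 2m - 1.\<close>
    have "mult_in W \<noteq> Suc (mult_in (W - {u, v}))"
    proof
      assume eq: "mult_in W = Suc (mult_in (W - {u, v}))"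
      have "mult_in W \<le> mult_in (W - {u})" "mult_in W \<le> mult_in (W - {v})"
        using none interlace_le[OF W] uv by (auto simp: le_Suc_eq)
      then show False
        using rayleigh_parity[OF W uv, of "mult_in W + mult_in (W - {u, v})"] eq by auto
    qed
    then show ?thesis using none H uC by auto
  qed
qed

end
end
end

section \<open>Transfer from \<open>S_graph \<theta> G\<close> to \<open>G\<close> without its
  special vertices\<close>

theorem theorem5p7:
  fixes G :: "'a graph" and \<theta> :: real and u v :: 'a
  assumes "simple_graph G"
    and "mult \<theta> G \<ge> 2"
    and "u \<in> verts G" and "v \<in> verts G" and "u \<noteq> v"
  shows "int (mult \<theta> (del_verts (S_graph \<theta> G) {u, v})) = int (mult \<theta> (S_graph \<theta> G)) - 1
    \<longleftrightarrow> ((u \<in> N_set \<theta> G \<and> v \<in> B_set \<theta> G) \<or> (v \<in> N_set \<theta> G \<and> u \<in> B_set \<theta> G)) \<or>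
        (\<exists>H. component_of H (del_verts G (A_set \<theta> G)) \<and> critical \<theta> H \<and>
             u \<in> verts H \<and> v \<in> verts H \<and> mult \<theta> (del_verts H {u, v}) = 0)"
proof -
  define V E A S where "V = verts G" and "E = edges G" and "A = A_set \<theta> G"
    and "S = edges (S_graph \<theta> G)"
  define W where "W = V - A"
  have fin: "finite V" using assms by (simp add: simple_graph_def V_def)
  have edge: "\<exists>u v. u \<noteq> v \<and> u \<in> V \<and> v \<in> V \<and> e = {u, v}" if "e \<in> E" for e
    using assms(1) that unfolding simple_graph_def V_def E_def by blast
  have AV: "A \<subseteq> V" by (auto simp: A_def A_set_def V_def)
  have finA: "finite A" and finW: "finite W" using fin AV finite_subset by (auto simp: W_def)
  have S: "S = E \<union> {{w, z} | w z. w \<in> A \<and> z \<in> V \<and> z \<noteq> w}"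
    by (simp add: S_def S_graph_def edges_def E_def A_def V_def)
  have edgeS: "\<exists>u v. u \<noteq> v \<and> u \<in> V \<and> v \<in> V \<and> e = {u, v}" if "e \<in> S" for e
    using that edge AV unfolding S by blast
  interpret g: edge_set_root E \<theta> by standard (use edge in blast)
  interpret s: edge_set_root S \<theta> by standard (use edgeS in blast)
  have G: "G = (V, {e \<in> E. e \<subseteq> V})"
    using edge by (auto simp: V_def E_def verts_def edges_def prod_eq_iff)
  have SG: "S_graph \<theta> G = (V, {e \<in> S. e \<subseteq> V})"
  proof -
    have "{e \<in> S. e \<subseteq> V} = S" using edgeS by blast
    then show ?thesis by (simp add: S_graph_def S_def V_def edges_def)
  qed
  have ess: "essential \<theta> G x \<longleftrightarrow> g.mult_in V = Suc (g.mult_in (V - {x}))" for x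
    unfolding essential_def by (subst (1 2) G) (auto simp: g.mult_del_induced g.mult_induced)
  have N: "x \<in> N_set \<theta> G \<longleftrightarrow> x \<in> V \<and> g.mult_in (V - {x}) = g.mult_in V" for x
  proof -
    have "neutral \<theta> G x \<longleftrightarrow> g.mult_in (V - {x}) = g.mult_in V"
      unfolding neutral_def by (subst (1 2) G) (simp add: g.mult_del_induced g.mult_induced)
    then show ?thesis by (simp add: N_set_def V_def)
  qed
  have B: "x \<in> B_set \<theta> G \<longleftrightarrow> x \<in> V \<and> g.mult_in V = Suc (g.mult_in (V - {x}))" for x
    by (simp add: B_set_def ess V_def)
  have A: "x \<in> A \<longleftrightarrow> x \<in> V \<and> g.mult_in V \<noteq> Suc (g.mult_in (V - {x})) \<and>
      (\<exists>w\<in>V. g.mult_in V = Suc (g.mult_in (V - {w})) \<and> {x, w} \<in> E)" for x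
    unfolding A_def A_set_def by (auto simp: ess B V_def E_def)
  have A_le: "g.mult_in V \<le> g.mult_in (V - {a})" if "a \<in> A" for a
    using that g.interlace_le[OF fin, of a] by (auto simp: A le_Suc_eq)
  have W: "g.mult_in W = g.mult_in V + card A" "\<And>x. x \<in> W \<Longrightarrow> g.mult_in (W - {x}) = g.mult_in (V - {x}) + card A"
    using g.mult_in_delete_special[OF fin AV A_le] unfolding W_def by (auto simp: A)
  have A_pos: "g.mult_in (V - {a}) = Suc (g.mult_in V)" if a: "a \<in> A" for a
  proof -
    obtain w where "w \<in> V" "g.mult_in V = Suc (g.mult_in (V - {w}))" "{a, w} \<in> E" using a A by blast
    then show ?thesis using g.special_positive[OF fin, of a w] A_le[OF a] a AV by blast
  qed
  have m2: "2 \<le> g.mult_in V" using assms(2) by (subst (asm) G) (simp add: g.mult_induced)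
  \<comment> \<open>Every added edge meets \<open>A\<close>, so both edge sets induce the same graph
    on subsets of \<open>W\<close>.\<close>
  have sg: "s.mult_in U = g.mult_in U" if "U \<subseteq> W" for U
  proof -
    have "{e \<in> S. e \<subseteq> U} = {e \<in> E. e \<subseteq> U}" using that unfolding S W_def by auto
    then show ?thesis by (simp add: s.mult_in_def g.mult_in_def s.mu_def g.mu_def)
  qed
  \<comment> \<open>The members of \<open>A\<close> outside \<open>X\<close> are still joined to
    everything, and adding each back lowers the multiplicity by one.\<close>
  have join: "s.mult_in (V - X) + card (A - X) = g.mult_in (W - X)" if "card (A - X) \<le> g.mult_in (W - X)" for X
  proof -
    have "{a, z} \<in> S" if "a \<in> A" "z \<in> V" "z \<noteq> a" for a z
      using that unfolding S by blast
    moreover have sW: "s.mult_in (W - X) = g.mult_in (W - X)" by (rule sg) auto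
    ultimately have "s.mult_in ((A - X) \<union> (W - X)) + card (A - X) = s.mult_in (W - X)"
      using finA finW that AV by (intro s.mult_in_join) (auto simp: W_def)
    moreover have "(A - X) \<union> (W - X) = V - X" using AV by (auto simp: W_def)
    ultimately show ?thesis by (simp add: sW)
  qed
  \<comment> \<open>Removing \<open>A\<close> from \<open>G\<close> raises the multiplicity by
    \<open>card A\<close>, and joining \<open>A\<close> back lowers it by the same amount.\<close>
  have mS: "mult \<theta> (S_graph \<theta> G) = g.mult_in V"
    using join[of "{}"] W(1) by (simp add: SG s.mult_induced)
  have mSuv: "mult \<theta> (del_verts (S_graph \<theta> G) {u, v}) = s.mult_in (V - {u, v})"
    by (simp add: SG s.mult_del_induced)
  have \<Gamma>: "del_verts G A = (W, {e \<in> E. e \<subseteq> W})"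
    by (subst G) (auto simp: del_verts_def verts_def edges_def W_def)
  have uV: "u \<in> V" "v \<in> V" using assms by (auto simp: V_def)
  have no_comp: "x \<notin> A" if "component_of H (del_verts G A)" "x \<in> verts H" for x H
  proof -
    have "verts H \<subseteq> W" using that(1) unfolding component_of_def \<Gamma>
      by (metis fst_conv verts_def verts_induced)
    then show ?thesis using that(2) by (auto simp: W_def)
  qed
  have lhs: "int (s.mult_in (V - {u, v})) = int (g.mult_in V) - 1 \<longleftrightarrow> g.mult_in V = Suc (s.mult_in (V - {u, v}))"
    by auto
  show ?thesis
  proof (cases "u \<in> A \<or> v \<in> A")
    case True
    \<comment> \<open>A deleted vertex of \<open>A\<close> is one fewer to join back, which offsets
      the loss of at most one from deleting a vertex of \<open>W\<close>; so the multiplicity cannot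
      drop.\<close>
    have "g.mult_in V \<le> s.mult_in (V - {u, v})"
    proof (cases "u \<in> A \<and> v \<in> A")
      case True
      then have "W - {u, v} = W" by (auto simp: W_def)
      moreover have "card (A - {u, v}) \<le> card A" using finA by (simp add: card_mono)
      ultimately show ?thesis using join[of "{u, v}"] W(1) by simp
    next
      case False
      then have "u \<in> A \<and> v \<in> W \<or> v \<in> A \<and> u \<in> W" using True uV by (auto simp: W_def)
      then obtain a b where ab: "{u, v} = {a, b}" "a \<in> A" "b \<in> W"
        by (metis insert_commute)
      have d: "W - {u, v} = W - {b}" "A - {u, v} = A - {a}"
        unfolding ab(1) using ab(2,3) by (auto simp: W_def)
      have "card A = Suc (card (A - {a}))" using ab finA by (metis card.remove)
      moreover have "g.mult_in W \<le> Suc (g.mult_in (W - {b}))" using g.interlace_le[OF finW ab(3)] .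
      ultimately show ?thesis using join[of "{u, v}"] W(1) m2 by (simp add: d)
    qed
    then have "g.mult_in V \<noteq> Suc (s.mult_in (V - {u, v}))" by simp
    moreover have "x \<notin> N_set \<theta> G" "x \<notin> B_set \<theta> G" if "x \<in> A" for x
      using A_pos[OF that] by (simp_all add: N B)
    ultimately show ?thesis
      using True no_comp unfolding mS mSuv lhs A_def[symmetric] by blast
  next
    case False
    then have uW: "u \<in> W" "v \<in> W" using uV by (auto simp: W_def)
    have "A - {u, v} = A" using False by auto
    \<comment> \<open>Two deletions cost at most two, so \<open>mult_in V \<ge> 2\<close> leaves at
      least \<open>card A\<close>, as \<open>join\<close> requires.\<close>
    moreover have "g.mult_in W \<le> Suc (Suc (g.mult_in (W - {u, v})))"
      using g.interlace_le[OF finW uW(1)] g.interlace2(2)[OF finW uW assms(5)] by linarith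
    ultimately have "s.mult_in (V - {u, v}) + card A = g.mult_in (W - {u, v})"
      using join[of "{u, v}"] W(1) m2 by simp
    then have iff: "g.mult_in V = Suc (s.mult_in (V - {u, v})) \<longleftrightarrow> g.mult_in W = Suc (g.mult_in (W - {u, v}))"
      using W(1) by auto
    have essW: "g.mult_in W = Suc (g.mult_in (W - {x})) \<longleftrightarrow> g.mult_in V = Suc (g.mult_in (V - {x}))"
      and neutW: "g.mult_in (W - {x}) = g.mult_in W \<longleftrightarrow> g.mult_in (V - {x}) = g.mult_in V" if "x \<in> W" for x
      using W(1) W(2)[OF that] by simp_all
    \<comment> \<open>Types in \<open>W\<close> agree with those in \<open>V\<close>, and a
      non-essential neighbour of an essential vertex would belong to \<open>A\<close>.\<close>
    have "\<forall>x\<in>W. \<forall>y\<in>W. {x, y} \<in> E \<longrightarrow>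
        g.mult_in W = Suc (g.mult_in (W - {y})) \<longrightarrow> g.mult_in W = Suc (g.mult_in (W - {x}))"
    proof (intro ballI impI)
      fix x y
      assume x: "x \<in> W" and y: "y \<in> W" and "{x, y} \<in> E" "g.mult_in W = Suc (g.mult_in (W - {y}))"
      moreover have "x \<in> V" "x \<notin> A" "y \<in> V" using x y by (auto simp: W_def)
      ultimately show "g.mult_in W = Suc (g.mult_in (W - {x}))"
        using A[of x] unfolding essW[OF x] essW[OF y] by blast
    qed
    note two = g.two_deleted[OF finW this uW assms(5)]
    show ?thesis
      unfolding mS mSuv lhs A_def[symmetric] \<Gamma> iff N B
      using two[unfolded essW[OF uW(1)] essW[OF uW(2)] neutW[OF uW(1)] neutW[OF uW(2)]] uV by argo
  qed
qed

end
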